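(* Let $\mathcal B$ be a building set on a finite set $V$ and let $(B,B',P)$ be an exchange frame of $\mathcal B$. Then $(B,B',P)$ is extremal if and only if it is maximal; that is, the inequality $\mathbf h_B+\mathbf h_{B'}+\sum_{K\in\kappa(P\setminus(B\cup B'))}\mathbf h_K>\mathbf h_P+\sum_{K\in\kappa(B\cap B')}\mathbf h_K$ defines a facet of the closure of the type cone $\mathbb{TC}(\Sigma_{\mathcal B})$ if and only if $B$ and $B'$ are both inclusion-maximal among the blocks of $\mathcal B$ strictly contained in $P$.
   Context: A building set on $V$ is a set $\mathcal B$ of non-empty subsets of $V$ (blocks) containing all singletons and such that $B,B'\in\mathcal B$, $B\cap B'\ne\varnothing$ imply $B\cup B'\in\mathcal B$. Its connected components $\kappa(\mathcal B)$ are its inclusion-maximal blocks; for $U\subseteq V$, $\kappa(U)$ denotes the set of inclusion-maximal blocks of $\{C\in\mathcal B:C\subseteq U\}$. A $\mathcal B$-nested set is $\mathcal N\subseteq\mathcal B$ such that any two members are nested or disjoint, no union of $k\ge2$ pairwise disjoint members lies in $\mathcal B$, and $\kappa(\mathcal B)\subseteq\mathcal N$. Two inclusion-maximal nested sets $\mathcal N,\mathcal N'$ are adjacent if $\mathcal N\setminus\{B\}=\mathcal N'\setminus\{B'\}$ with $B\ne B'$; then $\{C\in\mathcal N:B\subsetneq C\}=\{C\in\mathcal N':B'\subsetneq C\}$ has a unique inclusion-minimal element $P$ (the parent), and $(B,B',P)$ is called the frame of this exchange; an exchange frame is a triple arising this way. Let $\mathbb H=\{x\in\mathbb R^V:\sum_{v\in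 K}x_v=0\ \forall K\in\kappa(\mathcal B)\}$, $\mathbf g_B$ the orthogonal projection onto $\mathbb H$ of $\sum_{v\in B}e_v$, and $\Sigma_{\mathcal B}=\{\mathbb R_{\ge0}\{\mathbf g_C:C\in\mathcal N\}:\mathcal N \text{ nested set}\}$ (a complete simplicial fan in $\mathbb H$). The type cone $\mathbb{TC}(\Sigma_{\mathcal B})$ is the set of $\mathbf h\in\mathbb R^{\mathcal B}$ with $\mathbf h_K=0$ for $K\in\kappa(\mathcal B)$ such that $\Sigma_{\mathcal B}$ is the normal fan of $\{x\in\mathbb H:\langle\mathbf g_C,x\rangle\le\mathbf h_C\ \forall C\in\mathcal B\}$; every element of it satisfies the inequality of the claim for every exchange frame. An exchange frame is extremal if its inequality defines a facet of the closure of the type cone, and maximal if $B,B'$ are inclusion-maximal among blocks strictly contained in $P$. *)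

theory Defs
  imports "HOL-Analysis.Analysis"
begin

text \<open>The finite ground set $V$ is the universe of a finite type \<open>'v\<close>; then \<open>'v set\<close> is a
  finite type as well, so vectors indexed by sets of vertices live in \<open>real ^ 'v set\<close>.\<close>

definition building_set :: "'v::finite set set \<Rightarrow> bool" where
  "building_set \<B> \<longleftrightarrow>
     {} \<notin> \<B> \<and> (\<forall>v. {v} \<in> \<B>) \<and>
     (\<forall>B\<in>\<B>. \<forall>B'\<in>\<B>. B \<inter> B' \<noteq> {} \<longrightarrow> B \<union> B' \<in> \<B>)"

definition incl_maximals :: "'a set set \<Rightarrow> 'a set set" where
  "incl_maximals F = {X \<in> F. \<not> (\<exists>Y\<in>F. X \<subset> Y)}"

definition incl_minimals :: "'a set set \<Rightarrow> 'a set set" where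
  "incl_minimals F = {X \<in> F. \<not> (\<exists>Y\<in>F. Y \<subset> X)}"

definition block_components :: "'v set set \<Rightarrow> 'v set set" where
  "block_components \<B> = incl_maximals \<B>"

definition block_components_in :: "'v set set \<Rightarrow> 'v set \<Rightarrow> 'v set set" where
  "block_components_in \<B> U = incl_maximals {C \<in> \<B>. C \<subseteq> U}"

definition nested_set :: "'v::finite set set \<Rightarrow> 'v set set \<Rightarrow> bool" where
  "nested_set \<B> \<N> \<longleftrightarrow>
     \<N> \<subseteq> \<B> \<and>
     (\<forall>C\<in>\<N>. \<forall>D\<in>\<N>. C \<subseteq> D \<or> D \<subseteq> C \<or> C \<inter> D = {}) \<and>
     (\<forall>\<M>\<subseteq>\<N>. card \<M> \<ge> 2 \<and> pairwise disjnt \<M> \<longrightarrow> \<Union>\<M> \<notin> \<B>) \<and>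
     block_components \<B> \<subseteq> \<N>"

definition maximal_nested_set :: "'v::finite set set \<Rightarrow> 'v set set \<Rightarrow> bool" where
  "maximal_nested_set \<B> \<N> \<longleftrightarrow> \<N> \<in> incl_maximals {\<M>. nested_set \<B> \<M>}"

definition exchange_frame :: "'v::finite set set \<Rightarrow> 'v set \<Rightarrow> 'v set \<Rightarrow> 'v set \<Rightarrow> bool" where
  "exchange_frame \<B> B B' P \<longleftrightarrow>
     (\<exists>\<N> \<N>'. maximal_nested_set \<B> \<N> \<and> maximal_nested_set \<B> \<N>' \<and>
        B \<in> \<N> \<and> B' \<in> \<N>' \<and> B \<noteq> B' \<and> \<N> - {B} = \<N>' - {B'} \<and>
        P \<in> incl_minimals {C \<in> \<N>. B \<subset> C})"

definition ambient_space :: "'v::finite set set \<Rightarrow> (real ^ 'v) set" where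
  "ambient_space \<B> = {x. \<forall>K\<in>block_components \<B>. (\<Sum>v\<in>K. x $ v) = 0}"

definition orth_proj :: "'a::euclidean_space set \<Rightarrow> 'a \<Rightarrow> 'a" where
  "orth_proj S x = (THE p. p \<in> S \<and> x - p \<in> S\<^sup>\<bottom>)"

lemma orth_proj:
  fixes S :: "'a::euclidean_space set"
  assumes "subspace S"
  shows "orth_proj S x \<in> S" "x - orth_proj S x \<in> S\<^sup>\<bottom>"
proof -
  have S: "span S = S"
    using assms by (simp add: span_eq_iff)
  obtain y z where yz: "y \<in> span S" "\<And>w. w \<in> span S \<Longrightarrow> orthogonal z w" "x = y + z"
    using orthogonal_subspace_decomp_exists by blast
  then have y: "y \<in> S \<and> x - y \<in> S\<^sup>\<bottom>"
    unfolding S by (simp add: orthogonal_comp_def orthogonal_commute)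
  have unique: "p = y" if p: "p \<in> S \<and> x - p \<in> S\<^sup>\<bottom>" for p
  proof -
    have 1: "y - p \<in> S"
      using p y assms by (simp add: subspace_diff)
    have "(x - p) - (x - y) \<in> S\<^sup>\<bottom>"
      by (rule subspace_diff[OF subspace_orthogonal_comp]) (use p y in blast)+
    then have "y - p \<in> S\<^sup>\<bottom>"
      by simp
    with 1 have "orthogonal (y - p) (y - p)"
      unfolding orthogonal_comp_def by blast
    then show "p = y"
      by (simp add: orthogonal_self)
  qed
  have "\<exists>!p. p \<in> S \<and> x - p \<in> S\<^sup>\<bottom>"
    by (rule ex1I[of _ y]) (use y unique in blast)+
  from theI'[OF this] show "orth_proj S x \<in> S" "x - orth_proj S x \<in> S\<^sup>\<bottom>"
    unfolding orth_proj_def by blast+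
qed

definition g_vec :: "'v::finite set set \<Rightarrow> 'v set \<Rightarrow> real ^ 'v" where
  "g_vec \<B> B = orth_proj (ambient_space \<B>) (\<Sum>v\<in>B. axis v 1)"

definition nested_fan :: "'v::finite set set \<Rightarrow> (real ^ 'v) set set" where
  "nested_fan \<B> = {convex_cone hull (g_vec \<B> ` \<N>) |\<N>. nested_set \<B> \<N>}"

text \<open>Outer normal cones and normal fan of \<open>Q\<close>, taken inside the subspace \<open>S\<close>.\<close>

definition normal_cone :: "'a::euclidean_space set \<Rightarrow> 'a set \<Rightarrow> 'a set \<Rightarrow> 'a set" where
  "normal_cone S Q F = {u \<in> S. \<forall>x\<in>F. \<forall>y\<in>Q. u \<bullet> y \<le> u \<bullet> x}"

definition normal_fan :: "'a::euclidean_space set \<Rightarrow> 'a set \<Rightarrow> 'a set set" where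
  "normal_fan S Q = {normal_cone S Q F |F. F face_of Q \<and> F \<noteq> {}}"

definition nested_polytope :: "'v::finite set set \<Rightarrow> real ^ 'v set \<Rightarrow> (real ^ 'v) set" where
  "nested_polytope \<B> h = {x \<in> ambient_space \<B>. \<forall>C\<in>\<B>. g_vec \<B> C \<bullet> x \<le> h $ C}"

text \<open>The space $\mathbb{R}^{\mathcal B}$ is the coordinate subspace of \<open>real ^ 'v set\<close> of
  vectors vanishing outside \<open>\<B>\<close>.\<close>

definition type_cone :: "'v::finite set set \<Rightarrow> (real ^ 'v set) set" where
  "type_cone \<B> =
     {h. (\<forall>C. C \<notin> \<B> \<longrightarrow> h $ C = 0) \<and> (\<forall>K\<in>block_components \<B>. h $ K = 0) \<and>
         normal_fan (ambient_space \<B>) (nested_polytope \<B> h) = nested_fan \<B>}"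

text \<open>The inequality \<open>l h \<ge> r h\<close> is valid on \<open>S\<close>, and it is tight exactly on a facet of \<open>S\<close>.\<close>

definition defines_facet ::
  "('a::euclidean_space \<Rightarrow> real) \<Rightarrow> ('a \<Rightarrow> real) \<Rightarrow> 'a set \<Rightarrow> bool" where
  "defines_facet l r S \<longleftrightarrow> (\<forall>h\<in>S. l h \<ge> r h) \<and> {h \<in> S. l h = r h} facet_of S"

definition extremal_frame :: "'v::finite set set \<Rightarrow> 'v set \<Rightarrow> 'v set \<Rightarrow> 'v set \<Rightarrow> bool" where
  "extremal_frame \<B> B B' P \<longleftrightarrow>
     defines_facet
       (\<lambda>h. h $ B + h $ B' + (\<Sum>K\<in>block_components_in \<B> (P - (B \<union> B')). h $ K))
       (\<lambda>h. h $ P + (\<Sum>K\<in>block_components_in \<B> (B \<inter> B'). h $ K))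
       (closure (type_cone \<B>))"

definition maximal_frame :: "'v::finite set set \<Rightarrow> 'v set \<Rightarrow> 'v set \<Rightarrow> 'v set \<Rightarrow> bool" where
  "maximal_frame \<B> B B' P \<longleftrightarrow>
     B \<in> incl_maximals {C \<in> \<B>. C \<subset> P} \<and> B' \<in> incl_maximals {C \<in> \<B>. C \<subset> P}"

end

theory Submission
  imports Defs
begin

text \<open>
  Extend \<open>h\<close> to all vertex sets by \<open>h(U) = \<Sum>K\<in>\<kappa>(U). h\<^sub>K\<close>. Then the closed type cone consists of those
  \<open>h\<close> whose extension is submodular. For submodular extensions the greedy algorithm computes the
  support function of the polytope as a sum over level sets, so its normal cones are spanned by the
  tight blocks; if submodularity is strict wherever some block inside \<open>U \<union> W\<close> lies neither in \<open>U\<close> nor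
  in \<open>W\<close>, the tight families are exactly the nested sets.

  Writing \<open>h(U) = - \<Sum>C\<subseteq>U. y\<^sub>C\<close> over blocks \<open>C\<close>, the submodularity defect of \<open>(U, W)\<close> is the sum of
  \<open>y\<^sub>C\<close> over the blocks crossing \<open>(U, W)\<close>, and the defect of the frame \<open>(B, B', P)\<close> is the sum over
  the set \<open>T\<close> of blocks inside \<open>P\<close> contained in none of \<open>B\<close>, \<open>B'\<close>, \<open>P - (B \<union> B')\<close>. The coefficients of
  the non-singleton blocks are free coordinates. If \<open>B \<subset> D \<subset> P\<close> for a block \<open>D\<close>, splitting \<open>T\<close> into
  the blocks inside \<open>D\<close> and the others writes the frame inequality as a sum of two independent
  valid ones. If the frame is maximal, any crossing family that contains \<open>P\<close> and is contained in
  \<open>T\<close> equals \<open>T\<close>, which makes the inequality irredundant.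
\<close>

subsection \<open>Greedy points and level sets\<close>

text \<open>Edmonds' greedy algorithm: the elements enter by decreasing \<open>u\<close>, and each
  receives the marginal value of \<open>f\<close>. Every upper level set of \<open>u\<close> is then
  an initial segment of the order and hence tight.\<close>

lemma submodular_greedy_point:
  fixes f :: "'a set \<Rightarrow> real" and u :: "'a \<Rightarrow> real"
  assumes "finite A" "f {} = 0" and submod: "\<And>U W. f (U \<union> W) + f (U \<inter> W) \<le> f U + f W"
  obtains x where "\<And>t. sum x {v \<in> A. u v \<ge> t} = f {v \<in> A. u v \<ge> t}" "\<And>U. U \<subseteq> A \<Longrightarrow> sum x U \<le> f U"
proof -
  have "\<exists>x. sum x A = f A \<and> (\<forall>t. sum x {v \<in> A. u v \<ge> t} = f {v \<in> A. u v \<ge> t}) \<and>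
      (\<forall>U\<subseteq>A. sum x U \<le> f U)"
    using \<open>finite A\<close>
  \<comment> \<open>Ranking by \<open>- u\<close> makes the new element the one with the least value
    of \<open>u\<close>. The rule allows it to belong to \<open>A\<close> already, which the first
    case below disposes of.\<close>
  proof (induction A rule: finite_ranking_induct[where f = "\<lambda>v. - u v"])
    case empty
    then show ?case using \<open>f {} = 0\<close> by auto
  next
    case (insert a A)
    then obtain x where x: "sum x A = f A" "\<And>t. sum x {v \<in> A. u v \<ge> t} = f {v \<in> A. u v \<ge> t}"
      "\<And>U. U \<subseteq> A \<Longrightarrow> sum x U \<le> f U" by blast
    show ?case
    proof (cases "a \<in> A")
      case True
      then have "insert a A = A" by blast
      then show ?thesis using x by metis
    next
      case False
      define x' where "x' = x(a := f (insert a A) - f A)"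
      have x'_eq: "sum x' U = sum x U" if "a \<notin> U" for U
        unfolding x'_def by (rule sum.cong) (use that in auto)
      have x'_ins: "sum x' (insert a U) = f (insert a A) - f A + sum x U" if "a \<notin> U" "U \<subseteq> A" for U
        using that x'_eq[of U] finite_subset[OF that(2) insert.hyps(1)] by (simp add: x'_def)
      have total: "sum x' (insert a A) = f (insert a A)"
        using x'_ins[of A] False x(1) by simp
      moreover have "sum x' {v \<in> insert a A. u v \<ge> t} = f {v \<in> insert a A. u v \<ge> t}" for t
      proof (cases "u a \<ge> t")
        case True
        then have "{v \<in> insert a A. u v \<ge> t} = insert a A"
          using insert.hyps(2) by force
        then show ?thesis using total by simp
      next
        case u: False
        then have "{v \<in> insert a A. u v \<ge> t} = {v \<in> A. u v \<ge> t}" by auto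
        then show ?thesis using x(2)[of t] x'_eq[of "{v \<in> A. u v \<ge> t}"] False by simp
      qed
      moreover have "sum x' U \<le> f U" if U: "U \<subseteq> insert a A" for U
      proof (cases "a \<in> U")
        case True
        then have eqs: "U = insert a (U - {a})" "U \<union> A = insert a A" "U \<inter> A = U - {a}"
          using U False by auto
        have "sum x' U = f (insert a A) - f A + sum x (U - {a})"
          using x'_ins[of "U - {a}"] U eqs(1) by auto
        also have "\<dots> \<le> f (insert a A) - f A + f (U - {a})"
          using x(3)[of "U - {a}"] U by auto
        \<comment> \<open>Submodularity for \<open>U\<close> and \<open>A\<close>: the marginal
          value of \<open>a\<close> over \<open>A\<close> is at most the one over
          \<open>U - {a}\<close>.\<close>
        also have "\<dots> \<le> f U"
          using submod[of U A] eqs(2,3) by simp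
        finally show ?thesis .
      next
        case False
        then show ?thesis using U x(3)[of U] x'_eq[of U] by (simp add: subset_insert)
      qed
      ultimately show ?thesis by blast
    qed
  qed
  then show ?thesis using that by blast
qed

text \<open>Here \<open>m\<close> is the least element and \<open>l\<close> gives the gap to the
  preceding one, with value zero at the least. This layer-cake form serves to write a vector through
  the indicators of its level sets.\<close>

lemma finite_reals_as_partial_sums:
  fixes R :: "real set"
  assumes "finite R"
  shows "\<exists>m l. (\<forall>t. l t \<ge> (0::real)) \<and> (\<forall>a\<in>R. a = m + (\<Sum>t | t \<in> R \<and> t \<le> a. l t))"
  using assms
proof (induction R rule: finite_linorder_max_induct)
  case empty
  show ?case by (rule exI, rule exI[of _ "\<lambda>_. 0"]) simp
next
  case (insert b R)
  then obtain m l where ml: "\<And>t. l t \<ge> (0::real)" "\<And>a. a \<in> R \<Longrightarrow> a = m + (\<Sum>t | t \<in> R \<and> t \<le> a. l t)"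
    by blast
  show ?case
  proof (cases "R = {}")
    case True
    then show ?thesis by (intro exI[of _ b] exI[of _ "\<lambda>_. 0"]) simp
  next
    case False
    define M where "M = Max R"
    have M: "M \<in> R" "\<And>a. a \<in> R \<Longrightarrow> a \<le> M"
      using False insert.hyps(1) by (auto simp: M_def)
    define l' where "l' = l(b := b - M)"
    have "b \<notin> R" using insert.hyps(2) by auto
    have "l' t \<ge> 0" for t
      using ml(1)[of t] M(1) insert.hyps(2) by (auto simp: l'_def intro: less_imp_le)
    moreover have "a = m + (\<Sum>t | t \<in> insert b R \<and> t \<le> a. l' t)" if "a \<in> insert b R" for a
    proof (cases "a = b")
      case True
      have "{t. t \<in> insert b R \<and> t \<le> a} = insert b R"
        using True insert.hyps(2) by (auto intro: less_imp_le)
      moreover have "sum l' R = sum l R"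
        unfolding l'_def by (rule sum.cong) (use \<open>b \<notin> R\<close> in auto)
      moreover have "{t. t \<in> R \<and> t \<le> M} = R"
        using M by auto
      moreover have "sum l' (insert b R) = b - M + sum l' R"
        using \<open>b \<notin> R\<close> insert.hyps(1) by (simp add: l'_def)
      ultimately have "(\<Sum>t | t \<in> insert b R \<and> t \<le> a. l' t) = b - M + sum l R" "M = m + sum l R"
        using ml(2)[OF M(1)] by simp_all
      then show ?thesis
        using True by simp
    next
      case False
      then have a: "a \<in> R" "a < b" using that insert.hyps(2) by auto
      then have "{t. t \<in> insert b R \<and> t \<le> a} = {t. t \<in> R \<and> t \<le> a}" by auto
      moreover have "(\<Sum>t | t \<in> R \<and> t \<le> a. l' t) = (\<Sum>t | t \<in> R \<and> t \<le> a. l t)"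
        unfolding l'_def by (rule sum.cong) (use \<open>b \<notin> R\<close> in auto)
      ultimately show ?thesis using ml(2)[OF a(1)] by simp
    qed
    ultimately show ?thesis by blast
  qed
qed

lemma convex_cone_hull_sum:
  assumes "finite I" "\<And>i. i \<in> I \<Longrightarrow> f i \<in> convex_cone hull S"
  shows "sum f I \<in> convex_cone hull S"
  using assms by (induction I) (auto simp: convex_cone_hull_contains_0 convex_cone_hull_add)

lemma convex_cone_normal_cone:
  fixes S :: "'a::euclidean_space set"
  assumes "subspace S"
  shows "convex_cone (normal_cone S Q F)"
  unfolding convex_cone_iff normal_cone_def
  using subspace_0[OF assms] subspace_add[OF assms] subspace_scale[OF assms]
  by (auto simp: inner_add_left intro: add_mono mult_left_mono)

subsection \<open>Components and nested sets\<close>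

lemma mem_incl_maximals_iff: "X \<in> incl_maximals F \<longleftrightarrow> X \<in> F \<and> (\<forall>Y\<in>F. X \<subseteq> Y \<longrightarrow> Y = X)"
  unfolding incl_maximals_def by blast

locale building =
  fixes \<B> :: "'v::finite set set"
  assumes building: "building_set \<B>"
begin

abbreviation comps :: "'v set \<Rightarrow> 'v set set" (\<open>\<kappa>\<close>) where
  "\<kappa> \<equiv> block_components_in \<B>"

lemma block_nonempty: "C \<in> \<B> \<Longrightarrow> C \<noteq> {}"
  using building unfolding building_set_def by blast

lemma singleton_block: "{v} \<in> \<B>"
  using building unfolding building_set_def by blast

lemma block_Un: "C \<in> \<B> \<Longrightarrow> D \<in> \<B> \<Longrightarrow> C \<inter> D \<noteq> {} \<Longrightarrow> C \<union> D \<in> \<B>"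
  using building unfolding building_set_def by blast

lemma block_Un_Union:
  assumes "finite \<Y>" "C \<in> \<B>" "\<And>E. E \<in> \<Y> \<Longrightarrow> E \<in> \<B> \<and> E \<inter> C \<noteq> {}"
  shows "C \<union> \<Union>\<Y> \<in> \<B>"
  using assms
proof (induction \<Y>)
  case (insert E \<Y>)
  then have "C \<union> \<Union>\<Y> \<in> \<B>" "E \<in> \<B>" "(C \<union> \<Union>\<Y>) \<inter> E \<noteq> {}"
    by auto
  then have "(C \<union> \<Union>\<Y>) \<union> E \<in> \<B>"
    by (rule block_Un)
  then show ?case
    by (simp add: Un_ac)
qed simp

lemma comps_iff: "X \<in> \<kappa> U \<longleftrightarrow> X \<in> \<B> \<and> X \<subseteq> U \<and> (\<forall>Y\<in>\<B>. Y \<subseteq> U \<longrightarrow> X \<subseteq> Y \<longrightarrow> Y = X)"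
  unfolding block_components_in_def mem_incl_maximals_iff by blast

lemma comps_disjoint:
  assumes "X \<in> \<kappa> U" "Y \<in> \<kappa> U" "X \<noteq> Y"
  shows "X \<inter> Y = {}"
proof (rule ccontr)
  assume "X \<inter> Y \<noteq> {}"
  then have "X \<union> Y \<in> \<B>"
    using assms block_Un comps_iff by blast
  then have "X \<union> Y = X" "X \<union> Y = Y"
    using assms unfolding comps_iff by (meson Un_least Un_upper1 Un_upper2)+
  with assms show False by blast
qed

lemma block_le_comp:
  assumes "C \<in> \<B>" "C \<subseteq> U"
  obtains X where "X \<in> \<kappa> U" "C \<subseteq> X"
proof -
  have "finite {D \<in> \<B>. D \<subseteq> U}" "C \<in> {D \<in> \<B>. D \<subseteq> U}"
    using assms by auto
  from finite_has_maximal2[OF this] obtain X where X: "X \<in> {D \<in> \<B>. D \<subseteq> U}" "C \<subseteq> X"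
    "\<forall>D\<in>{D \<in> \<B>. D \<subseteq> U}. X \<subseteq> D \<longrightarrow> X = D" by blast
  then have "X \<in> \<kappa> U"
    unfolding comps_iff by blast
  with X(2) show ?thesis using that by blast
qed

lemma Union_comps: "\<Union>(\<kappa> U) = U"
proof
  show "\<Union>(\<kappa> U) \<subseteq> U"
    using comps_iff by blast
  show "U \<subseteq> \<Union>(\<kappa> U)"
  proof
    fix v assume "v \<in> U"
    then obtain X where "X \<in> \<kappa> U" "{v} \<subseteq> X"
      using block_le_comp[of "{v}" U] singleton_block by blast
    then show "v \<in> \<Union>(\<kappa> U)" by blast
  qed
qed

lemma comps_UNIV: "\<kappa> UNIV = block_components \<B>"
  unfolding block_components_def block_components_in_def by simp

lemma comps_block: "C \<in> \<B> \<Longrightarrow> \<kappa> C = {C}"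
  unfolding set_eq_iff comps_iff by blast

lemma comps_empty: "\<kappa> {} = {}"
  unfolding set_eq_iff comps_iff using block_nonempty by blast

lemma sum_comps: "(\<Sum>C\<in>\<kappa> U. sum f C) = sum f U" for f :: "'v \<Rightarrow> real"
proof -
  have "sum f (\<Union>(\<kappa> U)) = (\<Sum>C\<in>\<kappa> U. sum f C)"
    by (subst sum.Union_disjoint) (use comps_disjoint in auto)
  then show ?thesis by (simp add: Union_comps)
qed

text \<open>Each block inside \<open>U\<close> lies in exactly one component of \<open>U\<close>.
  Hence a formula of this shape for \<open>h\<close> on blocks carries over to \<open>ext h\<close>
  on arbitrary sets.\<close>

lemma sum_blocks_comps: "(\<Sum>C\<in>\<kappa> U. \<Sum>D | D \<in> \<B> \<and> D \<subseteq> C. c D) = (\<Sum>D | D \<in> \<B> \<and> D \<subseteq> U. c D)"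
  for c :: "'v set \<Rightarrow> real"
proof -
  have "{D. D \<in> \<B> \<and> D \<subseteq> U} = (\<Union>C\<in>\<kappa> U. {D. D \<in> \<B> \<and> D \<subseteq> C})"
  proof (intro set_eqI iffI)
    fix D assume "D \<in> {D. D \<in> \<B> \<and> D \<subseteq> U}"
    then have "D \<in> \<B>" "D \<subseteq> U" by auto
    from block_le_comp[OF this] obtain X where "X \<in> \<kappa> U" "D \<subseteq> X" .
    then show "D \<in> (\<Union>C\<in>\<kappa> U. {D. D \<in> \<B> \<and> D \<subseteq> C})"
      using \<open>D \<in> \<B>\<close> by blast
  next
    fix D assume "D \<in> (\<Union>C\<in>\<kappa> U. {D. D \<in> \<B> \<and> D \<subseteq> C})"
    then show "D \<in> {D. D \<in> \<B> \<and> D \<subseteq> U}"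
      using comps_iff by blast
  qed
  moreover have "{D. D \<in> \<B> \<and> D \<subseteq> C} \<inter> {D. D \<in> \<B> \<and> D \<subseteq> C'} = {}"
    if "C \<in> \<kappa> U" "C' \<in> \<kappa> U" "C \<noteq> C'" for C C'
    using comps_disjoint[OF that] block_nonempty by blast
  ultimately show ?thesis
    by (simp add: sum.UNION_disjoint)
qed

section \<open>Nested sets built from chains, and blocks covered by nested sets\<close>

lemma nested_setD:
  assumes "nested_set \<B> \<N>"
  shows "C \<in> \<N> \<Longrightarrow> C \<in> \<B>"
    and "C \<in> \<N> \<Longrightarrow> D \<in> \<N> \<Longrightarrow> C \<subseteq> D \<or> D \<subseteq> C \<or> C \<inter> D = {}"
    and "\<M> \<subseteq> \<N> \<Longrightarrow> card \<M> \<ge> 2 \<Longrightarrow> pairwise disjnt \<M> \<Longrightarrow> \<Union>\<M> \<notin> \<B>"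
    and "C \<in> block_components \<B> \<Longrightarrow> C \<in> \<N>"
  using assms unfolding nested_set_def by auto

text \<open>A block inside a smaller set of the chain lies in a single component of each larger one,
  which gives nestedness. The lemma supplies the nested sets against which members of the type cone
  are tested.\<close>

lemma nested_set_comps_chain:
  assumes chain: "\<And>U W. U \<in> \<U> \<Longrightarrow> W \<in> \<U> \<Longrightarrow> U \<subseteq> W \<or> W \<subseteq> U" and "UNIV \<in> \<U>"
  shows "nested_set \<B> (\<Union>U\<in>\<U>. \<kappa> U)"
  unfolding nested_set_def
proof (intro conjI ballI allI impI)
  show "(\<Union>U\<in>\<U>. \<kappa> U) \<subseteq> \<B>"
    using comps_iff by blast
  show "block_components \<B> \<subseteq> (\<Union>U\<in>\<U>. \<kappa> U)"
    using \<open>UNIV \<in> \<U>\<close> comps_UNIV by blast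
  have key: "C \<subseteq> D \<or> C \<inter> D = {}" if CD: "C \<in> \<kappa> U" "D \<in> \<kappa> W" "U \<subseteq> W" for C D U W
  proof -
    have "C \<in> \<B>" "C \<subseteq> W"
      using CD comps_iff by blast+
    from block_le_comp[OF this] obtain X where "X \<in> \<kappa> W" "C \<subseteq> X" .
    with CD comps_disjoint[of X W D] show ?thesis by blast
  qed
  show "C \<subseteq> D \<or> D \<subseteq> C \<or> C \<inter> D = {}" if "C \<in> (\<Union>U\<in>\<U>. \<kappa> U)" "D \<in> (\<Union>U\<in>\<U>. \<kappa> U)" for C D
  proof -
    obtain U W where UW: "U \<in> \<U>" "C \<in> \<kappa> U" "W \<in> \<U>" "D \<in> \<kappa> W"
      using \<open>C \<in> _\<close> \<open>D \<in> _\<close> by blast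
    with chain[of U W] show ?thesis
      using key[of C U D W] key[of D W C U] by blast
  qed
  fix \<M> assume sub: "\<M> \<subseteq> (\<Union>U\<in>\<U>. \<kappa> U)" and M: "2 \<le> card \<M> \<and> pairwise disjnt \<M>"
  show "\<Union>\<M> \<notin> \<B>"
  proof
    assume block: "\<Union>\<M> \<in> \<B>"
    have "\<forall>E\<in>\<M>. \<exists>U\<in>\<U>. E \<in> \<kappa> U"
      using sub by blast
    then obtain f where f: "\<And>E. E \<in> \<M> \<Longrightarrow> f E \<in> \<U> \<and> E \<in> \<kappa> (f E)"
      by metis
    have "\<M> \<noteq> {}"
      using M by auto
    \<comment> \<open>Among the chain sets \<open>f E\<close>, that of \<open>E0\<close> is the
      largest, so it contains all of \<open>\<Union>\<M>\<close>. If this union is a block, the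
      component \<open>E0\<close> has to be equal to it.\<close>
    then obtain E0 where E0: "E0 \<in> \<M>" "Max ((\<lambda>E. card (f E)) ` \<M>) = card (f E0)"
      using obtains_MAX[of \<M> "\<lambda>E. card (f E)"] by auto
    have E0_max: "card (f E) \<le> card (f E0)" if "E \<in> \<M>" for E
      unfolding E0(2)[symmetric] using that by (intro Max_ge) auto
    have "E \<subseteq> f E0" if "E \<in> \<M>" for E
    proof -
      have "f E \<subseteq> f E0"
        using chain[of "f E" "f E0"] f[OF that] f[OF E0(1)]
          card_seteq[OF finite, of "f E0" "f E"] E0_max[OF that] by blast
      then show ?thesis
        using f[OF that] comps_iff by blast
    qed
    then have "\<Union>\<M> \<subseteq> f E0" "E0 \<subseteq> \<Union>\<M>"
      using E0(1) by auto
    then have eq: "\<Union>\<M> = E0"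
      using f[OF E0(1)] block unfolding comps_iff by blast
    have "E = E0" if "E \<in> \<M>" for E
    proof (rule ccontr)
      assume "E \<noteq> E0"
      then have "E \<inter> E0 = {}"
        using M that E0(1) unfolding pairwise_def disjnt_def by blast
      moreover have "E \<subseteq> E0" "E \<noteq> {}"
        using eq that f[OF that] block_nonempty comps_iff by blast+
      ultimately show False by blast
    qed
    then have "\<M> = {E0}"
      using E0(1) by blast
    then show False
      using M by simp
  qed
qed

text \<open>The inclusion-maximal members of \<open>\<X>\<close> that meet \<open>C\<close> are
  pairwise disjoint, and \<open>C\<close> glues them into one block. The condition on disjoint
  unions then leaves room for only one of them.\<close>

lemma nested_block_in_Union:
  assumes N: "nested_set \<B> \<N>" and "\<X> \<subseteq> \<N>" and C: "C \<in> \<B>" "C \<subseteq> \<Union>\<X>"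
  shows "\<exists>E\<in>\<X>. C \<subseteq> E"
proof -
  define \<Y> where "\<Y> = {E \<in> incl_maximals \<X>. E \<inter> C \<noteq> {}}"
  have Y: "E \<in> \<X>" "E \<in> \<N>" "E \<in> \<B>" "E \<inter> C \<noteq> {}" if "E \<in> \<Y>" for E
    using that nested_setD(1)[OF N] \<open>\<X> \<subseteq> \<N>\<close> unfolding \<Y>_def mem_incl_maximals_iff by auto
  have Y_max: "D = E" if "D \<in> \<X>" "E \<in> \<Y>" "E \<subseteq> D" for D E
    using that unfolding \<Y>_def mem_incl_maximals_iff by simp
  have cover: "C \<subseteq> \<Union>\<Y>"
  proof
    fix v assume v: "v \<in> C"
    then obtain E where "E \<in> \<X>" "v \<in> E"
      using C(2) by blast
    moreover obtain E' where "E' \<in> \<X>" "E \<subseteq> E'" "\<forall>D\<in>\<X>. E' \<subseteq> D \<longrightarrow> E' = D"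
      using finite_has_maximal2[OF finite \<open>E \<in> \<X>\<close>] by blast
    ultimately have "E' \<in> \<Y>"
      using v unfolding \<Y>_def mem_incl_maximals_iff by auto
    then show "v \<in> \<Union>\<Y>"
      using \<open>E \<subseteq> E'\<close> \<open>v \<in> E\<close> by blast
  qed
  then have "C \<union> \<Union>\<Y> = \<Union>\<Y>"
    by blast
  then have block: "\<Union>\<Y> \<in> \<B>"
    using block_Un_Union[of \<Y> C] Y(3,4) C(1) by (metis finite)
  have disj: "pairwise disjnt \<Y>"
    unfolding pairwise_def disjnt_def
  proof (intro ballI impI)
    fix D E assume DE: "D \<in> \<Y>" "E \<in> \<Y>" "D \<noteq> E"
    then have "D \<subseteq> E \<or> E \<subseteq> D \<or> D \<inter> E = {}"
      using nested_setD(2)[OF N] Y(2) by simp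
    then show "D \<inter> E = {}"
      using DE Y(1) Y_max[of D E] Y_max[of E D] by metis
  qed
  have "\<Y> \<subseteq> \<N>"
    using Y by blast
  then have "\<not> card \<Y> \<ge> 2"
    using nested_setD(3)[OF N _ _ disj] block by blast
  moreover have "\<Y> \<noteq> {}"
    using cover C block_nonempty by blast
  ultimately have "card \<Y> = 1"
    using card_0_eq[OF finite, of \<Y>] by linarith
  then obtain E where "\<Y> = {E}"
    using card_1_singletonE by blast
  then show ?thesis
    using cover Y(1)[of E] by auto
qed

lemma nested_set_subset:
  assumes "nested_set \<B> \<N>" "\<M> \<subseteq> \<N>" "block_components \<B> \<subseteq> \<M>"
  shows "nested_set \<B> \<M>"
  unfolding nested_set_def
  using nested_setD(1-3)[OF assms(1)] assms(2,3) by (simp add: subset_iff)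

subsection \<open>Submodularity defects\<close>

definition ext :: "real ^ 'v set \<Rightarrow> 'v set \<Rightarrow> real" where
  "ext h U = (\<Sum>C\<in>\<kappa> U. h $ C)"

definition submod_gap :: "'v set \<Rightarrow> 'v set \<Rightarrow> real ^ 'v set \<Rightarrow> real" where
  "submod_gap U W h = ext h U + ext h W - ext h (U \<union> W) - ext h (U \<inter> W)"

definition crossing :: "'v set \<Rightarrow> 'v set \<Rightarrow> 'v set set" where
  "crossing U W = {C \<in> \<B>. C \<subseteq> U \<union> W \<and> \<not> C \<subseteq> U \<and> \<not> C \<subseteq> W}"

definition coord_space :: "(real ^ 'v set) set" where
  "coord_space = {h. (\<forall>C. C \<notin> \<B> \<longrightarrow> h $ C = 0) \<and> (\<forall>K\<in>block_components \<B>. h $ K = 0)}"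

definition submod_cone :: "(real ^ 'v set) set" where
  "submod_cone = {h \<in> coord_space. \<forall>U W. submod_gap U W h \<ge> 0}"

text \<open>Strictness is asked only where some block crosses, since elsewhere the defect vanishes
  identically (\<open>submod_gap_crossing_empty\<close>).\<close>

definition strict_submod_cone :: "(real ^ 'v set) set" where
  "strict_submod_cone =
     {h \<in> submod_cone. \<forall>U W. crossing U W \<noteq> {} \<longrightarrow> submod_gap U W h > 0}"

lemma ext_block: "C \<in> \<B> \<Longrightarrow> ext h C = h $ C"
  by (simp add: ext_def comps_block)

lemma ext_empty: "ext h {} = 0"
  by (simp add: ext_def comps_empty)

lemma linear_ext: "linear (\<lambda>h. ext h U)"
  by (rule linearI) (simp_all add: ext_def sum.distrib sum_distrib_left)

lemma linear_submod_gap: "linear (submod_gap U W)"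
proof -
  have "linear (\<lambda>h. ext h U + ext h W - ext h (U \<union> W) - ext h (U \<inter> W))"
    by (intro linear_compose_add linear_compose_sub linear_ext)
  then show ?thesis
    by (simp add: submod_gap_def[abs_def])
qed

lemma continuous_submod_gap: "continuous_on S (submod_gap U W)"
  using linear_submod_gap linear_continuous_on linear_conv_bounded_linear by blast

text \<open>Moebius inversion on the poset of blocks, by recursion on the cardinality.\<close>

lemma block_sum_inversion:
  fixes f :: "'v set \<Rightarrow> real"
  shows "\<exists>c. \<forall>C\<in>\<B>. f C = (\<Sum>D | D \<in> \<B> \<and> D \<subseteq> C. c D)"
proof -
  have "\<exists>c. \<forall>C\<in>\<B>. card C \<le> n \<longrightarrow> f C = (\<Sum>D | D \<in> \<B> \<and> D \<subseteq> C. c D)" for n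
  proof (induction n)
    case 0
    show ?case
      using block_nonempty by (simp add: card_0_eq)
  next
    case (Suc n)
    then obtain c where c: "\<forall>C\<in>\<B>. card C \<le> n \<longrightarrow> f C = (\<Sum>D | D \<in> \<B> \<and> D \<subseteq> C. c D)" ..
    \<comment> \<open>Blocks of size \<open>Suc n\<close> receive the coefficient that corrects
      their sum. Their proper subblocks are smaller and keep the old coefficients.\<close>
    define c' where "c' C = (if card C \<le> n then c C else f C - (\<Sum>D | D \<in> \<B> \<and> D \<subset> C. c D))" for C
    have "f C = (\<Sum>D | D \<in> \<B> \<and> D \<subseteq> C. c' D)" if C: "C \<in> \<B>" "card C \<le> Suc n" for C
    proof -
      have small: "c' D = c D" if "D \<subset> C" for D
        using psubset_card_mono[OF finite that] C(2) by (simp add: c'_def)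
      have split: "{D. D \<in> \<B> \<and> D \<subseteq> C} = insert C {D. D \<in> \<B> \<and> D \<subset> C}"
        using C by auto
      have s: "(\<Sum>D | D \<in> \<B> \<and> D \<subset> C. c' D) = (\<Sum>D | D \<in> \<B> \<and> D \<subset> C. c D)"
        by (rule sum.cong) (use small in auto)
      show ?thesis
      proof (cases "card C \<le> n")
        case True
        then have "f C = (\<Sum>D | D \<in> \<B> \<and> D \<subseteq> C. c D)"
          using c C by blast
        then show ?thesis
          using True by (simp add: split s) (simp add: c'_def)
      next
        case False
        then show ?thesis
          by (simp add: split s) (simp add: c'_def)
      qed
    qed
    then show ?case by blast
  qed
  from this[of "card (UNIV :: 'v set)"] obtain c
    where c: "\<forall>C\<in>\<B>. card C \<le> card (UNIV :: 'v set) \<longrightarrow> f C = (\<Sum>D | D \<in> \<B> \<and> D \<subseteq> C. c D)" ..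
  have "card C \<le> card (UNIV :: 'v set)" for C :: "'v set"
    by (rule card_mono) auto
  with c show ?thesis by blast
qed

lemma sum_blocks_crossing:
  fixes c :: "'v set \<Rightarrow> real"
  shows "(\<Sum>D | D \<in> \<B> \<and> D \<subseteq> U \<union> W. c D) + (\<Sum>D | D \<in> \<B> \<and> D \<subseteq> U \<inter> W. c D)
    = (\<Sum>D | D \<in> \<B> \<and> D \<subseteq> U. c D) + (\<Sum>D | D \<in> \<B> \<and> D \<subseteq> W. c D) + sum c (crossing U W)"
proof -
  let ?A = "{D. D \<in> \<B> \<and> D \<subseteq> U}" and ?B = "{D. D \<in> \<B> \<and> D \<subseteq> W}"
  have "{D. D \<in> \<B> \<and> D \<subseteq> U \<union> W} = (?A \<union> ?B) \<union> crossing U W"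
    by (auto simp: crossing_def)
  moreover have "sum c ((?A \<union> ?B) \<union> crossing U W) = sum c (?A \<union> ?B) + sum c (crossing U W)"
    by (rule sum.union_disjoint) (auto simp: crossing_def)
  moreover have "sum c (?A \<union> ?B) + sum c (?A \<inter> ?B) = sum c ?A + sum c ?B"
    by (rule sum.union_inter) auto
  moreover have "?A \<inter> ?B = {D. D \<in> \<B> \<and> D \<subseteq> U \<inter> W}"
    by auto
  ultimately show ?thesis by simp
qed

text \<open>For Moebius coefficients \<open>c\<close> of \<open>h\<close>, the value
  \<open>ext h U\<close> is the sum of \<open>c\<close> over the blocks inside \<open>U\<close>,
  whether or not \<open>U\<close> is a block. Inclusion-exclusion leaves the crossing blocks, and
  \<open>y = - c\<close>.\<close>

lemma submod_gap_as_sum: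
  obtains y where "\<And>U W. submod_gap U W h = sum y (crossing U W)"
proof -
  obtain c where c: "\<And>C. C \<in> \<B> \<Longrightarrow> h $ C = (\<Sum>D | D \<in> \<B> \<and> D \<subseteq> C. c D)"
    using block_sum_inversion[of "\<lambda>C. h $ C"] by blast
  have e: "ext h U = (\<Sum>D | D \<in> \<B> \<and> D \<subseteq> U. c D)" for U
  proof -
    have "ext h U = (\<Sum>C\<in>\<kappa> U. \<Sum>D | D \<in> \<B> \<and> D \<subseteq> C. c D)"
      unfolding ext_def by (rule sum.cong) (auto simp: c comps_iff)
    then show ?thesis by (simp add: sum_blocks_comps)
  qed
  have "submod_gap U W h = sum (\<lambda>D. - c D) (crossing U W)" for U W
    unfolding submod_gap_def e using sum_blocks_crossing[of c U W] by (simp add: sum_negf)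
  then show ?thesis using that by blast
qed

text \<open>Adding a modular function to \<open>ext h\<close> changes no defect, and this freedom is
  used to make \<open>h\<close> vanish on the connected components. So defects can be prescribed
  block by block.\<close>

lemma submod_gap_realize:
  fixes y :: "'v set \<Rightarrow> real"
  obtains h where "h \<in> coord_space" "\<And>U W. submod_gap U W h = sum y (crossing U W)"
proof -
  define s where "s C = (\<Sum>D | D \<in> \<B> \<and> D \<subseteq> C. y D)" for C
  define comp where "comp v = (THE K. K \<in> \<kappa> UNIV \<and> v \<in> K)" for v
  have comp: "comp v = K" if "K \<in> \<kappa> UNIV" "v \<in> K" for v K
    unfolding comp_def by (rule the_equality) (use that comps_disjoint in blast)+
  \<comment> \<open>Spreading \<open>s K\<close> evenly over each component \<open>K\<close> yields
    \<open>sum a K = s K\<close>, so that \<open>h\<close> is zero on \<open>K\<close>.\<close>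
  define a where "a v = s (comp v) / card (comp v)" for v
  define h :: "real ^ 'v set" where "h = (\<chi> C. if C \<in> \<B> then sum a C - s C else 0)"
  have "h $ K = 0" if K: "K \<in> \<kappa> UNIV" for K
  proof -
    have "sum a K = (\<Sum>v\<in>K. s K / card K)"
      by (rule sum.cong) (use comp[OF K] in \<open>auto simp: a_def\<close>)
    moreover have "K \<noteq> {}"
      using K comps_iff block_nonempty by blast
    ultimately have "sum a K = s K"
      by (simp add: card_gt_0_iff)
    then show ?thesis by (simp add: h_def)
  qed
  then have "h \<in> coord_space"
    unfolding coord_space_def comps_UNIV by (simp add: h_def)
  moreover have e: "ext h U = sum a U - s U" for U
  proof -
    have "ext h U = (\<Sum>C\<in>\<kappa> U. sum a C - s C)"
      unfolding ext_def by (rule sum.cong) (auto simp: h_def comps_iff)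
    also have "\<dots> = sum a U - s U"
      unfolding sum_subtractf sum_comps unfolding s_def sum_blocks_comps ..
    finally show ?thesis .
  qed
  have "submod_gap U W h = sum y (crossing U W)" for U W
  proof -
    have "sum a (U \<union> W) + sum a (U \<inter> W) = sum a U + sum a W"
      by (rule sum.union_inter) auto
    moreover have "s (U \<union> W) + s (U \<inter> W) = s U + s W + sum y (crossing U W)"
      unfolding s_def by (rule sum_blocks_crossing)
    ultimately show ?thesis
      unfolding submod_gap_def e by linarith
  qed
  ultimately show ?thesis using that by blast
qed

lemma submod_gap_crossing_empty: "crossing U W = {} \<Longrightarrow> submod_gap U W h = 0"
  by (metis submod_gap_as_sum sum.empty)

subsection \<open>Normal cones of the polytope\<close>

abbreviation ambient :: "(real ^ 'v) set" (\<open>\<H>\<close>) where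
  "\<H> \<equiv> ambient_space \<B>"

abbreviation gvec :: "'v set \<Rightarrow> real ^ 'v" (\<open>\<g>\<close>) where
  "\<g> \<equiv> g_vec \<B>"

lemma subspace_ambient: "subspace \<H>"
  unfolding ambient_space_def subspace_def
  by (auto simp: sum.distrib simp flip: sum_distrib_left)

lemma g_vec_ambient: "\<g> C \<in> \<H>"
  unfolding g_vec_def by (rule orth_proj(1)[OF subspace_ambient])

text \<open>An indicator vector differs from its projection by a vector orthogonal to
  \<open>\<H>\<close>. This turns the inequalities of the polytope into bounds on coordinate
  sums.\<close>

lemma inner_g_vec:
  assumes "y \<in> \<H>"
  shows "\<g> C \<bullet> y = (\<Sum>v\<in>C. y $ v)"
proof -
  have "(\<Sum>v\<in>C. axis v 1) - \<g> C \<in> \<H>\<^sup>\<bottom>"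
    unfolding g_vec_def by (rule orth_proj(2)[OF subspace_ambient])
  then have "((\<Sum>v\<in>C. axis v 1) - \<g> C) \<bullet> y = 0"
    using assms by (auto simp: orthogonal_comp_def orthogonal_def inner_commute)
  then show ?thesis
    by (simp add: inner_diff_left inner_sum_left inner_axis')
qed

lemma ambient_sum_comp: "y \<in> \<H> \<Longrightarrow> K \<in> \<kappa> UNIV \<Longrightarrow> (\<Sum>v\<in>K. y $ v) = 0"
  by (simp add: ambient_space_def comps_UNIV)

lemma ambient_sum_UNIV:
  assumes "y \<in> \<H>"
  shows "(\<Sum>v\<in>UNIV. y $ v) = 0"
  using sum_comps[of "\<lambda>v. y $ v" UNIV] ambient_sum_comp[OF assms] by simp

lemma g_vec_component:
  assumes "K \<in> \<kappa> UNIV"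
  shows "\<g> K = 0"
  using inner_g_vec[OF g_vec_ambient, of K K] ambient_sum_comp[OF g_vec_ambient assms] by simp

lemma ambient_eqI:
  assumes "u \<in> \<H>" "w \<in> \<H>" "\<And>y. y \<in> \<H> \<Longrightarrow> u \<bullet> y = w \<bullet> y"
  shows "u = w"
proof -
  have "u - w \<in> \<H>"
    using assms(1,2) by (simp add: subspace_ambient subspace_diff)
  from assms(3)[OF this] have "(u - w) \<bullet> (u - w) = 0"
    by (simp add: inner_diff_left)
  then show ?thesis by simp
qed

lemma nested_polytope_iff:
  "x \<in> nested_polytope \<B> h \<longleftrightarrow> x \<in> \<H> \<and> (\<forall>C\<in>\<B>. (\<Sum>v\<in>C. x $ v) \<le> h $ C)"
  unfolding nested_polytope_def using inner_g_vec by auto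

lemma nested_polytope_sum_le_ext:
  assumes "x \<in> nested_polytope \<B> h"
  shows "(\<Sum>v\<in>U. x $ v) \<le> ext h U"
proof -
  have "(\<Sum>v\<in>U. x $ v) = (\<Sum>C\<in>\<kappa> U. \<Sum>v\<in>C. x $ v)"
    by (rule sum_comps[symmetric])
  also have "\<dots> \<le> ext h U"
    unfolding ext_def by (rule sum_mono) (use assms nested_polytope_iff comps_iff in blast)
  finally show ?thesis .
qed

text \<open>The slacks of the components are nonnegative and add up to the slack of
  \<open>U\<close>, which is zero.\<close>

lemma tight_comps:
  assumes "x \<in> nested_polytope \<B> h" "(\<Sum>v\<in>U. x $ v) = ext h U" "C \<in> \<kappa> U"
  shows "(\<Sum>v\<in>C. x $ v) = h $ C"
proof -
  have le: "(\<Sum>v\<in>D. x $ v) \<le> h $ D" if "D \<in> \<kappa> U" for D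
    using assms(1) that nested_polytope_iff comps_iff by blast
  have "(\<Sum>D\<in>\<kappa> U. h $ D - (\<Sum>v\<in>D. x $ v)) = 0"
    using assms(2) by (simp add: sum_subtractf sum_comps ext_def)
  then have "\<forall>D\<in>\<kappa> U. h $ D - (\<Sum>v\<in>D. x $ v) = 0"
    by (subst (asm) sum_nonneg_eq_0_iff) (use le in auto)
  then show ?thesis using assms(3) by simp
qed

text \<open>The greedy algorithm for \<open>ext h\<close>. What remains is to see that the
  coordinates sum to zero over each component, not only over all vertices.\<close>

lemma greedy_point:
  fixes u :: "'v \<Rightarrow> real"
  assumes "h \<in> submod_cone"
  obtains x where "x \<in> nested_polytope \<B> h"
    "\<And>t. (\<Sum>v | u v \<ge> t. x $ v) = ext h {v. u v \<ge> t}"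
proof -
  have h: "h \<in> coord_space" "\<And>U W. submod_gap U W h \<ge> 0"
    using assms unfolding submod_cone_def by auto
  have "ext h (U \<union> W) + ext h (U \<inter> W) \<le> ext h U + ext h W" for U W
    using h(2)[of U W] by (simp add: submod_gap_def)
  from submodular_greedy_point[of UNIV "ext h" u, OF finite ext_empty this]
  obtain x where x: "\<And>t. sum x {v \<in> UNIV. u v \<ge> t} = ext h {v \<in> UNIV. u v \<ge> t}"
    "\<And>U. U \<subseteq> UNIV \<Longrightarrow> sum x U \<le> ext h U"
    by blast
  have le: "sum x C \<le> h $ C" if "C \<in> \<B>" for C
    using x(2)[of C] ext_block[OF that] by simp
  have hK: "h $ K = 0" if "K \<in> \<kappa> UNIV" for K
    using h(1) that by (simp add: coord_space_def comps_UNIV)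
  \<comment> \<open>The lowest threshold selects every vertex, so the total is
    \<open>ext h UNIV\<close>, which is zero. As each component sum is at most zero, all of them
    vanish.\<close>
  have "{v. u v \<ge> Min (range u)} = UNIV"
    by auto
  then have "sum x UNIV = ext h UNIV"
    using x(1)[of "Min (range u)"] by simp
  also have "\<dots> = 0"
    using hK by (simp add: ext_def)
  finally have "(\<Sum>K\<in>\<kappa> UNIV. - sum x K) = 0"
    by (simp add: sum_negf sum_comps)
  moreover have "\<forall>K\<in>\<kappa> UNIV. - sum x K \<ge> 0"
  proof
    fix K assume K: "K \<in> \<kappa> UNIV"
    then have "K \<in> \<B>" using comps_iff by blast
    from le[OF this] hK[OF K] show "- sum x K \<ge> 0" by simp
  qed
  ultimately have "\<forall>K\<in>\<kappa> UNIV. - sum x K = 0"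
    by (subst (asm) sum_nonneg_eq_0_iff) auto
  then have "(\<chi> v. x v) \<in> nested_polytope \<B> h"
    using le by (simp add: nested_polytope_iff ambient_space_def comps_UNIV)
  then show ?thesis
    using that[of "\<chi> v. x v"] x(1) by simp
qed

text \<open>The layer-cake form of \<open>u\<close> has a constant part, which pairs to zero with
  \<open>\<H>\<close>. Comparing inner products on \<open>\<H>\<close> then replaces the indicator
  of each level set by the \<open>\<g>\<close> vectors of its components.\<close>

lemma level_set_decomposition:
  assumes "u \<in> \<H>"
  obtains l where "\<And>t. l t \<ge> (0::real)"
    "\<And>y. y \<in> \<H> \<Longrightarrow> u \<bullet> y = (\<Sum>t\<in>range (($) u). l t * (\<Sum>v | u $ v \<ge> t. y $ v))"
    "u = (\<Sum>t\<in>range (($) u). l t *\<^sub>R (\<Sum>C\<in>\<kappa> {v. u $ v \<ge> t}. \<g> C))"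
proof -
  let ?R = "range (($) u)"
  obtain m l where l: "\<And>t. l t \<ge> (0::real)" and
    ml: "\<And>a. a \<in> ?R \<Longrightarrow> a = m + (\<Sum>t | t \<in> ?R \<and> t \<le> a. l t)"
    using finite_reals_as_partial_sums[of ?R] by auto
  have inner: "u \<bullet> y = (\<Sum>t\<in>?R. l t * (\<Sum>v | u $ v \<ge> t. y $ v))" if y: "y \<in> \<H>" for y
  proof -
    have uv: "u $ v = m + (\<Sum>t\<in>?R. if u $ v \<ge> t then l t else 0)" for v
      using ml[of "u $ v"] by (simp add: sum.inter_filter)
    have "u \<bullet> y = (\<Sum>v\<in>UNIV. (m + (\<Sum>t\<in>?R. if u $ v \<ge> t then l t else 0)) * y $ v)"
      unfolding inner_vec_def inner_real_def using uv by (intro sum.cong) auto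
    also have "\<dots> = m * (\<Sum>v\<in>UNIV. y $ v) + (\<Sum>v\<in>UNIV. \<Sum>t\<in>?R. if u $ v \<ge> t then l t * y $ v else 0)"
      by (simp add: distrib_right sum.distrib sum_distrib_left sum_distrib_right)
        (intro sum.cong refl, simp)
    also have "\<dots> = (\<Sum>t\<in>?R. \<Sum>v\<in>UNIV. if u $ v \<ge> t then l t * y $ v else 0)"
      unfolding ambient_sum_UNIV[OF y] by (subst sum.swap) simp
    also have "\<dots> = (\<Sum>t\<in>?R. l t * (\<Sum>v | u $ v \<ge> t. y $ v))"
      by (simp add: sum_distrib_left flip: sum.inter_filter)
    finally show ?thesis .
  qed
  have "u = (\<Sum>t\<in>?R. l t *\<^sub>R (\<Sum>C\<in>\<kappa> {v. u $ v \<ge> t}. \<g> C))"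
  proof (rule ambient_eqI[OF assms])
    show "(\<Sum>t\<in>?R. l t *\<^sub>R (\<Sum>C\<in>\<kappa> {v. u $ v \<ge> t}. \<g> C)) \<in> \<H>"
      by (intro subspace_sum subspace_scale subspace_ambient g_vec_ambient)
    fix y assume y: "y \<in> \<H>"
    show "u \<bullet> y = (\<Sum>t\<in>?R. l t *\<^sub>R (\<Sum>C\<in>\<kappa> {v. u $ v \<ge> t}. \<g> C)) \<bullet> y"
      by (simp add: inner[OF y] inner_sum_left inner_g_vec[OF y] sum_comps)
  qed
  with l inner that show ?thesis by blast
qed

section \<open>Tight families and normal cones\<close>

definition tight :: "real ^ 'v set \<Rightarrow> (real ^ 'v) set \<Rightarrow> 'v set set" where
  "tight h F = {C \<in> \<B>. \<forall>x\<in>F. (\<Sum>v\<in>C. x $ v) = h $ C}"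

lemma tight_face_normal:
  assumes "F \<subseteq> nested_polytope \<B> h" "D \<in> tight h F"
  shows "\<g> D \<in> normal_cone \<H> (nested_polytope \<B> h) F"
  unfolding normal_cone_def
proof (intro CollectI conjI ballI g_vec_ambient)
  fix x y assume xy: "x \<in> F" "y \<in> nested_polytope \<B> h"
  have "x \<in> \<H>" "y \<in> \<H>" "D \<in> \<B>" "(\<Sum>v\<in>D. x $ v) = h $ D" "(\<Sum>v\<in>D. y $ v) \<le> h $ D"
    using xy assms nested_polytope_iff by (auto simp: tight_def)
  then show "\<g> D \<bullet> y \<le> \<g> D \<bullet> x"
    by (simp add: inner_g_vec)
qed

text \<open>For \<open>u\<close> in the normal cone, points of \<open>F\<close> do at least as well
  as the greedy point for \<open>u\<close>, which attains the bound on every level set. So every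
  level set of positive weight is tight on \<open>F\<close>, and
  \<open>level_set_decomposition\<close> expresses \<open>u\<close> through tight blocks.\<close>

lemma normal_cone_eq_tight_cone:
  assumes h: "h \<in> submod_cone" and F: "F \<subseteq> nested_polytope \<B> h" "F \<noteq> {}"
  shows "normal_cone \<H> (nested_polytope \<B> h) F = convex_cone hull (\<g> ` tight h F)"
proof
  show "convex_cone hull (\<g> ` tight h F) \<subseteq> normal_cone \<H> (nested_polytope \<B> h) F"
  proof (rule hull_minimal)
    show "\<g> ` tight h F \<subseteq> normal_cone \<H> (nested_polytope \<B> h) F"
      using tight_face_normal[OF F(1)] by blast
  qed (rule convex_cone_normal_cone[OF subspace_ambient])
  show "normal_cone \<H> (nested_polytope \<B> h) F \<subseteq> convex_cone hull (\<g> ` tight h F)"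
  proof
    fix u assume "u \<in> normal_cone \<H> (nested_polytope \<B> h) F"
    then have u: "u \<in> \<H>" "\<And>x y. x \<in> F \<Longrightarrow> y \<in> nested_polytope \<B> h \<Longrightarrow> u \<bullet> y \<le> u \<bullet> x"
      by (auto simp: normal_cone_def)
    let ?R = "range (($) u)" and ?U = "\<lambda>t. {v. u $ v \<ge> t}"
    obtain l where l: "\<And>t. l t \<ge> (0::real)" and
      inner: "\<And>y. y \<in> \<H> \<Longrightarrow> u \<bullet> y = (\<Sum>t\<in>?R. l t * (\<Sum>v\<in>?U t. y $ v))" and
      u_eq: "u = (\<Sum>t\<in>?R. l t *\<^sub>R (\<Sum>C\<in>\<kappa> (?U t). \<g> C))"
      using level_set_decomposition[OF u(1)] by blast
    obtain z where z: "z \<in> nested_polytope \<B> h" "\<And>t. (\<Sum>v\<in>?U t. z $ v) = ext h (?U t)"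
      using greedy_point[OF h, of "($) u"] by blast
    have tight: "\<kappa> (?U t) \<subseteq> tight h F" if t: "t \<in> ?R" "l t > 0" for t
    proof
      fix C assume C: "C \<in> \<kappa> (?U t)"
      have "(\<Sum>v\<in>C. x $ v) = h $ C" if x: "x \<in> F" for x
      proof -
        have xQ: "x \<in> nested_polytope \<B> h"
          using x F(1) by blast
        have "u \<bullet> z \<le> u \<bullet> x"
          using u(2)[OF x z(1)] .
        \<comment> \<open>The left side is \<open>u \<bullet> z - u \<bullet> x\<close>, because
          \<open>z\<close> has no slack on any level set.\<close>
        then have "(\<Sum>s\<in>?R. l s * (ext h (?U s) - (\<Sum>v\<in>?U s. x $ v))) \<le> 0"
          using xQ z nested_polytope_iff
          by (simp add: inner right_diff_distrib sum_subtractf)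
        moreover have nonneg: "l s * (ext h (?U s) - (\<Sum>v\<in>?U s. x $ v)) \<ge> 0" for s
          using l[of s] nested_polytope_sum_le_ext[OF xQ, of "?U s"] by simp
        ultimately have "(\<Sum>s\<in>?R. l s * (ext h (?U s) - (\<Sum>v\<in>?U s. x $ v))) = 0"
          by (intro antisym sum_nonneg) auto
        then have "\<forall>s\<in>?R. l s * (ext h (?U s) - (\<Sum>v\<in>?U s. x $ v)) = 0"
          by (subst (asm) sum_nonneg_eq_0_iff) (use nonneg in auto)
        then have "(\<Sum>v\<in>?U t. x $ v) = ext h (?U t)"
          using t by (metis less_irrefl mult_eq_0_iff right_minus_eq)
        then show ?thesis
          using tight_comps[OF xQ _ C] by blast
      qed
      then show "C \<in> tight h F"
        using C comps_iff by (simp add: tight_def)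
    qed
    have "l t *\<^sub>R (\<Sum>C\<in>\<kappa> (?U t). \<g> C) \<in> convex_cone hull (\<g> ` tight h F)" if "t \<in> ?R" for t
    proof (cases "l t = 0")
      case True
      then show ?thesis by (simp add: convex_cone_hull_contains_0)
    next
      case False
      then have "l t > 0" using l[of t] by simp
      show ?thesis
        by (intro convex_cone_hull_mul convex_cone_hull_sum hull_inc)
          (use tight[OF that \<open>l t > 0\<close>] l in auto)
    qed
    then show "u \<in> convex_cone hull (\<g> ` tight h F)"
      by (subst u_eq, intro convex_cone_hull_sum) auto
  qed
qed

text \<open>Uncrossing: the sums of \<open>x\<close> are modular, so tightness of \<open>U\<close>
  and \<open>W\<close> forces the defect to be at most zero. It is therefore zero, the union is
  tight, and strictness excludes crossing blocks.\<close>

lemma tight_Un: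
  assumes h: "h \<in> strict_submod_cone" and x: "x \<in> nested_polytope \<B> h"
    and tight: "(\<Sum>v\<in>U. x $ v) = ext h U" "(\<Sum>v\<in>W. x $ v) = ext h W"
  shows "(\<Sum>v\<in>U \<union> W. x $ v) = ext h (U \<union> W)" "crossing U W = {}"
proof -
  have modular: "(\<Sum>v\<in>U \<union> W. x $ v) + (\<Sum>v\<in>U \<inter> W. x $ v) = (\<Sum>v\<in>U. x $ v) + (\<Sum>v\<in>W. x $ v)"
    by (rule sum.union_inter) auto
  note le = nested_polytope_sum_le_ext[OF x, of "U \<union> W"] nested_polytope_sum_le_ext[OF x, of "U \<inter> W"]
  have "submod_gap U W h \<le> 0"
    using modular le tight by (simp add: submod_gap_def)
  moreover have "submod_gap U W h \<ge> 0" "crossing U W \<noteq> {} \<Longrightarrow> submod_gap U W h > 0"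
    using h by (simp_all add: strict_submod_cone_def submod_cone_def)
  ultimately show "crossing U W = {}" "(\<Sum>v\<in>U \<union> W. x $ v) = ext h (U \<union> W)"
    using modular le tight unfolding submod_gap_def by force+
qed

lemma component_tight:
  assumes "h \<in> submod_cone" "F \<subseteq> nested_polytope \<B> h"
  shows "block_components \<B> \<subseteq> tight h F"
proof
  fix K assume K: "K \<in> block_components \<B>"
  then have "h $ K = 0" "K \<in> \<B>"
    using assms(1) comps_iff[of K UNIV]
    by (simp_all add: submod_cone_def coord_space_def comps_UNIV)
  moreover have "(\<Sum>v\<in>K. x $ v) = 0" if "x \<in> F" for x
    using that assms(2) K ambient_sum_comp[of x K] nested_polytope_iff by (auto simp: comps_UNIV)
  ultimately show "K \<in> tight h F"
    by (simp add: tight_def)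
qed

text \<open>Each violation of nestedness would produce a block crossing two tight sets, against
  \<open>tight_Un\<close>: the union \<open>C \<union> D\<close> of overlapping incomparable blocks,
  or a block that is a union of disjoint ones.\<close>

lemma nested_set_tight_point:
  assumes h: "h \<in> strict_submod_cone" and x: "x \<in> nested_polytope \<B> h"
  shows "nested_set \<B> (tight h {x})"
  unfolding nested_set_def
proof (intro conjI ballI allI impI)
  have t: "C \<in> \<B>" "(\<Sum>v\<in>C. x $ v) = ext h C" if "C \<in> tight h {x}" for C
    using that by (simp_all add: tight_def ext_block)
  show "tight h {x} \<subseteq> \<B>"
    using t(1) by blast
  have "h \<in> submod_cone"
    using h by (simp add: strict_submod_cone_def)
  then show "block_components \<B> \<subseteq> tight h {x}"
    using x by (intro component_tight) auto
  show "C \<subseteq> D \<or> D \<subseteq> C \<or> C \<inter> D = {}" if "C \<in> tight h {x}" "D \<in> tight h {x}" for C D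
  proof (rule ccontr)
    assume not: "\<not> (C \<subseteq> D \<or> D \<subseteq> C \<or> C \<inter> D = {})"
    then have "C \<union> D \<in> crossing C D"
      using block_Un[OF t(1) t(1)] that by (auto simp: crossing_def)
    then show False
      using tight_Un(2)[OF h x t(2) t(2)] that by blast
  qed
  fix \<M> assume sub: "\<M> \<subseteq> tight h {x}" and M: "2 \<le> card \<M> \<and> pairwise disjnt \<M>"
  \<comment> \<open>Repeated uncrossing; this is needed because \<open>\<Union>(\<M> - {C})\<close>
    may fail to be a block.\<close>
  have tight_Union: "(\<Sum>v\<in>\<Union>\<X>. x $ v) = ext h (\<Union>\<X>)" if "\<X> \<subseteq> tight h {x}" for \<X>
    using finite[of \<X>] that
  proof (induction \<X>)
    case (insert C \<X>)
    then show ?case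
      using tight_Un(1)[OF h x t(2)[of C], of "\<Union>\<X>"] by simp
  qed (simp add: ext_empty)
  show "\<Union>\<M> \<notin> \<B>"
  proof
    assume block: "\<Union>\<M> \<in> \<B>"
    have "\<M> \<noteq> {}" using M by auto
    then obtain C where C: "C \<in> \<M>" by blast
    have "card (\<M> - {C}) \<noteq> 0"
      using M C by (simp add: card_Diff_singleton)
    then obtain D where D: "D \<in> \<M>" "D \<noteq> C"
      by (metis Diff_iff all_not_in_conv card.empty insertCI)
    have C_disj: "E \<inter> C = {}" if "E \<in> \<M>" "E \<noteq> C" for E
      using M that C unfolding pairwise_def disjnt_def by blast
    have "C \<noteq> {}" "D \<noteq> {}"
      using C D t(1) sub block_nonempty by auto
    have "\<Union>\<M> \<in> crossing C (\<Union>(\<M> - {C}))"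
      unfolding crossing_def
    proof (intro CollectI conjI block)
      show "\<Union>\<M> \<subseteq> C \<union> \<Union>(\<M> - {C})" by blast
      show "\<not> \<Union>\<M> \<subseteq> C" using C_disj[OF D] D(1) \<open>D \<noteq> {}\<close> by blast
      show "\<not> \<Union>\<M> \<subseteq> \<Union>(\<M> - {C})" using C C_disj \<open>C \<noteq> {}\<close> by blast
    qed
    moreover have "crossing C (\<Union>(\<M> - {C})) = {}"
      by (rule tight_Un(2)[OF h x t(2) tight_Union]) (use sub C in auto)
    ultimately show False by blast
  qed
qed

lemma nested_set_tight:
  assumes h: "h \<in> strict_submod_cone" and F: "F \<subseteq> nested_polytope \<B> h" "F \<noteq> {}"
  shows "nested_set \<B> (tight h F)"
proof -
  obtain x where x: "x \<in> F" using F(2) by blast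
  show ?thesis
  proof (rule nested_set_subset)
    show "nested_set \<B> (tight h {x})"
      using nested_set_tight_point[OF h] x F(1) by blast
    show "tight h F \<subseteq> tight h {x}"
      using x by (auto simp: tight_def)
    show "block_components \<B> \<subseteq> tight h F"
      using h F(1) by (intro component_tight) (simp_all add: strict_submod_cone_def)
  qed
qed

text \<open>The greedy point for the order that lists the vertices by the size of the smallest member of
  \<open>\<N>\<close> containing them, those of \<open>Z\<close> last among vertices of equal size.\<close>

lemma nested_set_greedy_point:
  assumes N: "nested_set \<B> \<N>" and h: "h \<in> submod_cone"
    and Z: "\<And>v E. v \<in> Z \<Longrightarrow> E \<in> \<N> \<Longrightarrow> v \<in> E \<Longrightarrow> k \<le> card E"
  obtains x where "x \<in> nested_polytope \<B> h" "\<forall>E\<in>\<N>. (\<Sum>v\<in>E. x $ v) = h $ E"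
    "(\<Sum>v\<in>\<Union>{E \<in> \<N>. card E \<le> k} - Z. x $ v) = ext h (\<Union>{E \<in> \<N>. card E \<le> k} - Z)"
proof -
  define mn where "mn v = Min (card ` {E \<in> \<N>. v \<in> E})" for v
  have mn_mem: "mn v \<in> card ` {E \<in> \<N>. v \<in> E}" for v
  proof -
    have "v \<in> \<Union>(\<kappa> UNIV)" by (simp add: Union_comps)
    then obtain K where "K \<in> \<N>" "v \<in> K"
      using nested_setD(4)[OF N] by (auto simp: comps_UNIV)
    then show ?thesis
      unfolding mn_def by (intro Min_in) auto
  qed
  have mn_le: "mn v \<le> card E" if "E \<in> \<N>" "v \<in> E" for v E
    unfolding mn_def using that by (intro Min_le) auto
  define U where "U j = \<Union>{E \<in> \<N>. card E \<le> j}" for j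
  have U: "v \<in> U j \<longleftrightarrow> mn v \<le> j" for v j
    using mn_mem[of v] mn_le[of _ v] unfolding U_def by fastforce
  \<comment> \<open>The values \<open>mn v\<close> are integers, so the shift by 1/2 puts
    \<open>Z\<close> behind the vertices of equal size but before those of larger size.\<close>
  define u where "u v = - real (mn v) - (if v \<in> Z then 1/2 else 0)" for v
  obtain x where x: "x \<in> nested_polytope \<B> h"
    "\<And>t. (\<Sum>v | u v \<ge> t. x $ v) = ext h {v. u v \<ge> t}"
    using greedy_point[OF h, of u] by blast
  show ?thesis
  proof
    show "x \<in> nested_polytope \<B> h" by fact
  next
    show "\<forall>E\<in>\<N>. (\<Sum>v\<in>E. x $ v) = h $ E"
    proof
      fix E assume E: "E \<in> \<N>"
      have "u v \<ge> - real (card E) - 1/2 \<longleftrightarrow> mn v \<le> card E" for v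
        by (cases "v \<in> Z") (auto simp: u_def)
      then have "{v. u v \<ge> - real (card E) - 1/2} = U (card E)"
        using U by auto
      then have "(\<Sum>v\<in>U (card E). x $ v) = ext h (U (card E))"
        using x(2)[of "- real (card E) - 1/2"] by simp
      \<comment> \<open>A block between \<open>E\<close> and this union lies in one member of
        \<open>\<N>\<close> of size at most \<open>card E\<close>, and that member can only be
        \<open>E\<close>.\<close>
      moreover have "E \<in> \<kappa> (U (card E))"
        unfolding comps_iff
      proof (intro conjI ballI impI)
        show "E \<in> \<B>" using nested_setD(1)[OF N E] .
        show "E \<subseteq> U (card E)" using E unfolding U_def by blast
        fix D assume D: "D \<in> \<B>" "D \<subseteq> U (card E)" "E \<subseteq> D"
        then obtain E' where E': "E' \<in> \<N>" "card E' \<le> card E" "D \<subseteq> E'"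
          using nested_block_in_Union[OF N, of "{E' \<in> \<N>. card E' \<le> card E}" D] unfolding U_def by auto
        then have "E = E'"
          using card_seteq[OF finite, of E E'] D(3) by blast
        then show "D = E" using E' D by blast
      qed
      ultimately show "(\<Sum>v\<in>E. x $ v) = h $ E"
        using tight_comps[OF x(1)] by blast
    qed
  next
    \<comment> \<open>Vertices of \<open>Z\<close> have \<open>mn v\<close> at least
      \<open>k\<close>, so the half-step shift pushes exactly them below the threshold.\<close>
    have uk: "u v \<ge> - real k \<longleftrightarrow> mn v \<le> k \<and> v \<notin> Z" for v
    proof (cases "v \<in> Z")
      case True
      then have "k \<le> mn v" using mn_mem[of v] Z by auto
      then show ?thesis using True by (simp add: u_def)
    qed (simp add: u_def)
    have "{v. u v \<ge> - real k} = U k - Z" unfolding uk set_eq_iff by (simp add: U)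
    then show "(\<Sum>v\<in>\<Union>{E \<in> \<N>. card E \<le> k} - Z. x $ v) = ext h (\<Union>{E \<in> \<N>. card E \<le> k} - Z)"
      using x(2)[of "- real k"] unfolding U_def by simp
  qed
qed

text \<open>Let \<open>D\<close> be the smallest member of \<open>\<N>\<close> containing
  \<open>C\<close>, and \<open>Z\<close> the part of \<open>C\<close> outside all members strictly
  inside \<open>D\<close>; it is nonempty by minimality of \<open>D\<close>. Listing
  \<open>Z\<close> last makes a set tight that together with \<open>C\<close> is crossed by
  \<open>D\<close>, so \<open>C\<close> itself cannot be tight.\<close>

lemma nested_set_slack_point:
  assumes N: "nested_set \<B> \<N>" and h: "h \<in> strict_submod_cone" and C: "C \<in> \<B>" "C \<notin> \<N>"
  obtains x where "x \<in> nested_polytope \<B> h" "\<forall>E\<in>\<N>. (\<Sum>v\<in>E. x $ v) = h $ E"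
    "(\<Sum>v\<in>C. x $ v) \<noteq> h $ C"
proof -
  have h': "h \<in> submod_cone"
    using h by (simp add: strict_submod_cone_def)
  obtain K where K: "K \<in> \<kappa> UNIV" "C \<subseteq> K"
    using block_le_comp[OF C(1), of UNIV] by auto
  then have "K \<in> {E \<in> \<N>. C \<subseteq> E}"
    using nested_setD(4)[OF N] by (simp add: comps_UNIV)
  from finite_has_minimal2[OF finite this] obtain D where
    D': "D \<in> {E \<in> \<N>. C \<subseteq> E}" "\<forall>E\<in>{E \<in> \<N>. C \<subseteq> E}. E \<subseteq> D \<longrightarrow> D = E"
    by blast
  then have D: "D \<in> \<N>" "C \<subseteq> D" and D_min: "E \<in> \<N> \<Longrightarrow> C \<subseteq> E \<Longrightarrow> E \<subseteq> D \<Longrightarrow> D = E" for E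
    by auto
  define Z where "Z = C - \<Union>{E \<in> \<N>. E \<subset> D}"
  have "Z \<noteq> {}"
  proof
    assume "Z = {}"
    then have "C \<subseteq> \<Union>{E \<in> \<N>. E \<subset> D}"
      unfolding Z_def by blast
    then obtain E where "E \<in> \<N>" "E \<subset> D" "C \<subseteq> E"
      using nested_block_in_Union[OF N, of "{E \<in> \<N>. E \<subset> D}" C] C(1) by auto
    then show False using D_min[of E] by blast
  qed
  let ?W = "\<Union>{E \<in> \<N>. card E \<le> card D} - Z"
  have Z_card: "card D \<le> card E" if v: "v \<in> Z" "E \<in> \<N>" "v \<in> E" for v E
  proof -
    have "D \<subseteq> E \<or> E \<subseteq> D \<or> D \<inter> E = {}"
      using nested_setD(2)[OF N] D(1) v(2) by blast
    then have "D \<subseteq> E"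
      using v D(2) unfolding Z_def by blast
    then show ?thesis by (intro card_mono) auto
  qed
  obtain x where x: "x \<in> nested_polytope \<B> h"
    "\<forall>E\<in>\<N>. (\<Sum>v\<in>E. x $ v) = h $ E" "(\<Sum>v\<in>?W. x $ v) = ext h ?W"
    by (rule nested_set_greedy_point[OF N h' Z_card])
  have "D \<in> crossing C ?W"
    unfolding crossing_def
  proof (intro CollectI conjI)
    show "D \<in> \<B>" using nested_setD(1)[OF N D(1)] .
    show "D \<subseteq> C \<union> ?W" using D(1) unfolding Z_def by blast
    show "\<not> D \<subseteq> C" using D C(2) by auto
    show "\<not> D \<subseteq> ?W" using \<open>Z \<noteq> {}\<close> D(2) unfolding Z_def by blast
  qed
  then have "(\<Sum>v\<in>C. x $ v) \<noteq> h $ C"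
    using tight_Un(2)[OF h x(1) _ x(3), of C] ext_block[OF C(1)] by auto
  with x that show ?thesis by blast
qed

lemma convex_nested_polytope: "convex (nested_polytope \<B> h)"
proof -
  have "nested_polytope \<B> h = \<H> \<inter> (\<Inter>C\<in>\<B>. {x. \<g> C \<bullet> x \<le> h $ C})"
    unfolding nested_polytope_def by auto
  then show ?thesis
    by (simp add: convex_Int subspace_imp_convex subspace_ambient convex_INT convex_halfspace_le)
qed

text \<open>The sum of the \<open>\<g>\<close> vectors of \<open>\<N>\<close> is a single functional
  that exposes the whole set: its bound is attained only if every summand attains its own.\<close>

lemma face_of_nested_polytope:
  assumes "\<N> \<subseteq> \<B>"
  shows "{x \<in> nested_polytope \<B> h. \<forall>C\<in>\<N>. (\<Sum>v\<in>C. x $ v) = h $ C} face_of nested_polytope \<B> h"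
proof -
  define w where "w = (\<Sum>C\<in>\<N>. \<g> C)"
  have w: "w \<bullet> x = (\<Sum>C\<in>\<N>. \<Sum>v\<in>C. x $ v)" if "x \<in> nested_polytope \<B> h" for x
    using that by (simp add: w_def inner_sum_left inner_g_vec nested_polytope_iff)
  have le: "(\<Sum>v\<in>C. x $ v) \<le> h $ C" if "x \<in> nested_polytope \<B> h" "C \<in> \<N>" for x C
    using that assms nested_polytope_iff by blast
  have "(\<forall>C\<in>\<N>. (\<Sum>v\<in>C. x $ v) = h $ C) \<longleftrightarrow> w \<bullet> x = (\<Sum>C\<in>\<N>. h $ C)"
    if x: "x \<in> nested_polytope \<B> h" for x
  proof -
    have "w \<bullet> x = (\<Sum>C\<in>\<N>. h $ C) \<longleftrightarrow> (\<Sum>C\<in>\<N>. h $ C - (\<Sum>v\<in>C. x $ v)) = 0"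
      unfolding w[OF x] sum_subtractf by auto
    also have "\<dots> \<longleftrightarrow> (\<forall>C\<in>\<N>. h $ C - (\<Sum>v\<in>C. x $ v) = 0)"
      by (rule sum_nonneg_eq_0_iff) (use le[OF x] in auto)
    finally show ?thesis by auto
  qed
  then have "{x \<in> nested_polytope \<B> h. \<forall>C\<in>\<N>. (\<Sum>v\<in>C. x $ v) = h $ C}
      = nested_polytope \<B> h \<inter> {x. w \<bullet> x = (\<Sum>C\<in>\<N>. h $ C)}"
    by auto
  moreover have "w \<bullet> x \<le> (\<Sum>C\<in>\<N>. h $ C)" if "x \<in> nested_polytope \<B> h" for x
    unfolding w[OF that] by (rule sum_mono) (rule le[OF that])
  ultimately show ?thesis
    using face_of_Int_supporting_hyperplane_le[OF convex_nested_polytope, of h w] by simp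
qed

text \<open>Tight families of nonempty faces are nested sets, and conversely each nested set is the
  tight family of the face it defines. Normal cones are generated by tight families, so the two fans
  agree.\<close>

lemma strict_submod_cone_subset_type_cone: "strict_submod_cone \<subseteq> type_cone \<B>"
proof
  fix h assume h: "h \<in> strict_submod_cone"
  then have h': "h \<in> submod_cone" "h \<in> coord_space"
    by (simp_all add: strict_submod_cone_def submod_cone_def)
  let ?Q = "nested_polytope \<B> h"
  have "normal_fan \<H> ?Q = nested_fan \<B>"
  proof
    show "normal_fan \<H> ?Q \<subseteq> nested_fan \<B>"
    proof
      fix c assume "c \<in> normal_fan \<H> ?Q"
      then obtain F where F: "c = normal_cone \<H> ?Q F" "F face_of ?Q" "F \<noteq> {}"
        by (auto simp: normal_fan_def)
      then have sub: "F \<subseteq> ?Q" by (simp add: face_of_imp_subset)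
      show "c \<in> nested_fan \<B>"
        unfolding nested_fan_def F(1) normal_cone_eq_tight_cone[OF h'(1) sub F(3)]
        using nested_set_tight[OF h sub F(3)] by blast
    qed
    show "nested_fan \<B> \<subseteq> normal_fan \<H> ?Q"
    proof
      fix c assume "c \<in> nested_fan \<B>"
      then obtain \<N> where N: "c = convex_cone hull (\<g> ` \<N>)" "nested_set \<B> \<N>"
        by (auto simp: nested_fan_def)
      define F where "F = {x \<in> ?Q. \<forall>C\<in>\<N>. (\<Sum>v\<in>C. x $ v) = h $ C}"
      have NB: "\<N> \<subseteq> \<B>" using nested_setD(1)[OF N(2)] by blast
      have face: "F face_of ?Q"
        unfolding F_def by (rule face_of_nested_polytope[OF NB])
      obtain x where "x \<in> ?Q" "\<forall>E\<in>\<N>. (\<Sum>v\<in>E. x $ v) = h $ E"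
        using nested_set_greedy_point[OF N(2) h'(1), of "{}" 0] by auto
      then have ne: "F \<noteq> {}" unfolding F_def by blast
      have "tight h F = \<N>"
      proof
        show "\<N> \<subseteq> tight h F" using NB unfolding tight_def F_def by blast
        show "tight h F \<subseteq> \<N>"
        proof
          fix C assume C: "C \<in> tight h F"
          show "C \<in> \<N>"
          proof (rule ccontr)
            assume "C \<notin> \<N>"
            moreover have "C \<in> \<B>" using C by (simp add: tight_def)
            ultimately obtain x where x: "x \<in> ?Q" "\<forall>E\<in>\<N>. (\<Sum>v\<in>E. x $ v) = h $ E"
              "(\<Sum>v\<in>C. x $ v) \<noteq> h $ C"
              using nested_set_slack_point[OF N(2) h] by metis
            then have "x \<in> F" by (simp add: F_def)
            with C x(3) show False by (simp add: tight_def)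
          qed
        qed
      qed
      moreover have "F \<subseteq> ?Q" unfolding F_def by blast
      ultimately have "c = normal_cone \<H> ?Q F"
        using normal_cone_eq_tight_cone[OF h'(1) _ ne] N(1) by simp
      then show "c \<in> normal_fan \<H> ?Q"
        unfolding normal_fan_def using face ne by blast
    qed
  qed
  with h'(2) show "h \<in> type_cone \<B>"
    by (simp add: type_cone_def coord_space_def)
qed

subsection \<open>The closed type cone\<close>

text \<open>Pairing with \<open>axis a 1 - axis b 1\<close> for \<open>a\<close>, \<open>b\<close>
  in one component recovers the indicators up to the factor \<open>c\<close>. It follows that a ray
  determines its block.\<close>

lemma g_vec_proportional:
  assumes C: "C \<in> \<B>" and D: "D \<in> \<B>" "D \<notin> \<kappa> UNIV" and eq: "\<g> D = c *\<^sub>R \<g> C" and "c \<ge> 0"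
  shows "D = C"
proof -
  obtain K where K: "K \<in> \<kappa> UNIV" "D \<subseteq> K"
    using block_le_comp[OF D(1), of UNIV] by auto
  have pair: "of_bool (a \<in> D) - of_bool (b \<in> D) = c * (of_bool (a \<in> C) - of_bool (b \<in> C))"
    if ab: "a \<in> K" "b \<in> K" for a b
  proof -
    define y :: "real ^ 'v" where "y = axis a 1 - axis b 1"
    have y: "(\<Sum>v\<in>S. y $ v) = of_bool (a \<in> S) - of_bool (b \<in> S)" for S
      by (simp add: y_def axis_def sum_subtractf)
    have "(a \<in> K') = (b \<in> K')" if "K' \<in> \<kappa> UNIV" for K'
      using ab comps_disjoint[OF K(1) that] by blast
    then have "y \<in> \<H>"
      unfolding ambient_space_def comps_UNIV[symmetric] by (simp add: y)
    then show ?thesis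
      using inner_g_vec[of y D] inner_g_vec[of y C] by (simp add: eq y)
  qed
  have "D \<noteq> K" using D(2) K(1) by blast
  then obtain b where b: "b \<in> K" "b \<notin> D" using K(2) by blast
  obtain a where a: "a \<in> D" using block_nonempty[OF D(1)] by blast
  then have "1 = c * (of_bool (a \<in> C) - of_bool (b \<in> C))"
    using pair[of a b, OF subsetD[OF K(2) a] b(1)] b(2) by simp
  then have c: "c \<noteq> 0" and aC: "a \<in> C" and bC: "b \<notin> C"
    using \<open>c \<ge> 0\<close> by (auto simp: of_bool_def split: if_splits)
  have "C \<subseteq> K"
  proof -
    obtain K' where "K' \<in> \<kappa> UNIV" "C \<subseteq> K'"
      using block_le_comp[OF C, of UNIV] by auto
    then show ?thesis
      using comps_disjoint[OF K(1), of K'] a aC K(2) by blast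
  qed
  have "x \<in> D \<longleftrightarrow> x \<in> C" if "x \<in> K" for x
    using pair[OF that b(1)] b(2) bC c by (auto simp: of_bool_def split: if_splits)
  then show ?thesis
    using K(2) \<open>C \<subseteq> K\<close> by blast
qed

lemma type_cone_face:
  assumes "h \<in> type_cone \<B>" "nested_set \<B> \<N>"
  obtains F where "F face_of nested_polytope \<B> h" "F \<noteq> {}"
    "normal_cone \<H> (nested_polytope \<B> h) F = convex_cone hull (\<g> ` \<N>)"
proof -
  have "convex_cone hull (\<g> ` \<N>) \<in> nested_fan \<B>"
    using assms(2) unfolding nested_fan_def by blast
  then have "convex_cone hull (\<g> ` \<N>) \<in> normal_fan \<H> (nested_polytope \<B> h)"
    using assms(1) by (simp add: type_cone_def)
  then show ?thesis
    using that unfolding normal_fan_def by blast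
qed

text \<open>From any \<open>y\<close> in \<open>F\<close> the segment can be prolonged slightly
  beyond \<open>x\<close> within \<open>F\<close>. A linear function that is maximal at the inner
  point \<open>x\<close> is then constant along it.\<close>

lemma tight_rel_interior:
  assumes F: "convex F" "F \<subseteq> nested_polytope \<B> h" and x: "x \<in> rel_interior F"
  shows "tight h {x} \<subseteq> tight h F"
proof
  fix D assume D: "D \<in> tight h {x}"
  have "(\<Sum>v\<in>D. y $ v) = h $ D" if y: "y \<in> F" for y
  proof -
    obtain e where e: "e > 1" "(1 - e) *\<^sub>R y + e *\<^sub>R x \<in> F"
      using convex_rel_interior_if2[OF F(1) x] y hull_inc[of y F affine] by blast
    define z where "z = (1 - e) *\<^sub>R y + e *\<^sub>R x"
    have "(\<Sum>v\<in>D. z $ v) \<le> h $ D"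
      using e(2) D F(2) nested_polytope_iff by (auto simp: z_def tight_def)
    moreover have "(\<Sum>v\<in>D. z $ v) = (1 - e) * (\<Sum>v\<in>D. y $ v) + e * h $ D"
      using D by (simp add: z_def tight_def sum.distrib flip: sum_distrib_left)
    ultimately have "(e - 1) * h $ D \<le> (e - 1) * (\<Sum>v\<in>D. y $ v)"
      by (simp add: algebra_simps)
    then have "h $ D \<le> (\<Sum>v\<in>D. y $ v)"
      using e(1) by simp
    moreover have "(\<Sum>v\<in>D. y $ v) \<le> h $ D"
      using y D F(2) nested_polytope_iff by (auto simp: tight_def)
    ultimately show ?thesis by simp
  qed
  then show "D \<in> tight h F"
    using D by (simp add: tight_def)
qed

text \<open>No inequality of the polytope is redundant. Otherwise the face whose normal cone is the
  ray of \<open>\<g> C\<close> has a relative interior point where all noncomponent inequalities are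
  slack. A small move along \<open>\<g> C\<close> stays in the polytope, contrary to normality
  unless \<open>\<g> C\<close> is zero.\<close>

lemma type_cone_attained:
  assumes h: "h \<in> type_cone \<B>" and C: "C \<in> \<B>"
  shows "\<exists>x\<in>nested_polytope \<B> h. (\<Sum>v\<in>C. x $ v) = h $ C"
proof (rule ccontr)
  let ?Q = "nested_polytope \<B> h"
  assume "\<not> ?thesis"
  then have slack: "(\<Sum>v\<in>C. x $ v) \<noteq> h $ C" if "x \<in> ?Q" for x
    using that by blast
  have hK: "h $ K = 0" if "K \<in> \<kappa> UNIV" for K
    using h that by (simp add: type_cone_def comps_UNIV)
  have "nested_set \<B> (\<Union>U\<in>{C, UNIV}. \<kappa> U)"
    by (rule nested_set_comps_chain) auto
  then have nested: "nested_set \<B> (insert C (\<kappa> UNIV))"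
    by (simp add: comps_block[OF C])
  obtain F where F: "F face_of ?Q" "F \<noteq> {}"
    and nc: "normal_cone \<H> ?Q F = convex_cone hull (\<g> ` insert C (\<kappa> UNIV))"
    using type_cone_face[OF h nested] by blast
  have FQ: "F \<subseteq> ?Q" "convex F"
    using F(1) face_of_imp_subset face_of_imp_convex by blast+
  obtain x where x: "x \<in> rel_interior F"
    using rel_interior_eq_empty[OF FQ(2)] F(2) by blast
  have xF: "x \<in> F" using x rel_interior_subset by blast
  have xQ: "x \<in> ?Q" using xF FQ(1) by blast
  \<comment> \<open>Components have zero \<open>\<g>\<close> vectors and contribute nothing to the
    cone.\<close>
  have ray: "convex_cone hull (\<g> ` insert C (\<kappa> UNIV)) \<subseteq> {c *\<^sub>R \<g> C | c. c \<ge> 0}"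
  proof (rule hull_minimal)
    have "\<g> C = 1 *\<^sub>R \<g> C" "(0 :: real ^ 'v) = 0 *\<^sub>R \<g> C"
      by simp_all
    then have "\<g> C \<in> {c *\<^sub>R \<g> C | c. c \<ge> 0}" "0 \<in> {c *\<^sub>R \<g> C | c. c \<ge> 0}"
      using zero_le_one by blast+
    then show "\<g> ` insert C (\<kappa> UNIV) \<subseteq> {c *\<^sub>R \<g> C | c. c \<ge> 0}"
      by (auto simp: g_vec_component)
    show "convex_cone {c *\<^sub>R \<g> C | c. c \<ge> 0}"
      unfolding convex_cone_iff
    proof (intro conjI ballI allI impI)
      show "0 \<in> {c *\<^sub>R \<g> C | c. c \<ge> 0}" by fact
      fix p q assume "p \<in> {c *\<^sub>R \<g> C | c. c \<ge> 0}" "q \<in> {c *\<^sub>R \<g> C | c. c \<ge> 0}"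
      then obtain a b where "p = a *\<^sub>R \<g> C" "a \<ge> 0" "q = b *\<^sub>R \<g> C" "b \<ge> 0" by blast
      then have "p + q = (a + b) *\<^sub>R \<g> C" "a + b \<ge> 0"
        by (simp_all add: scaleR_left_distrib)
      then show "p + q \<in> {c *\<^sub>R \<g> C | c. c \<ge> 0}" by blast
    next
      fix p and d :: real assume "p \<in> {c *\<^sub>R \<g> C | c. c \<ge> 0}" "d \<ge> 0"
      then obtain a where "p = a *\<^sub>R \<g> C" "a \<ge> 0" by blast
      then have "d *\<^sub>R p = (d * a) *\<^sub>R \<g> C" "d * a \<ge> 0"
        using \<open>d \<ge> 0\<close> by simp_all
      then show "d *\<^sub>R p \<in> {c *\<^sub>R \<g> C | c. c \<ge> 0}" by blast
    qed
  qed
  have loose: "\<g> D \<bullet> x < h $ D" if D: "D \<in> \<B>" "D \<notin> \<kappa> UNIV" for D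
  proof (rule ccontr)
    assume "\<not> \<g> D \<bullet> x < h $ D"
    moreover have "x \<in> \<H>" "(\<Sum>v\<in>D. x $ v) \<le> h $ D"
      using xQ D(1) nested_polytope_iff by blast+
    ultimately have "D \<in> tight h {x}"
      using D(1) by (simp add: tight_def inner_g_vec)
    then have "D \<in> tight h F"
      using tight_rel_interior[OF FQ(2,1) x] by blast
    then have "\<g> D \<in> normal_cone \<H> ?Q F"
      by (rule tight_face_normal[OF FQ(1)])
    then obtain c where "\<g> D = c *\<^sub>R \<g> C" "c \<ge> 0"
      using nc ray by blast
    then have "D = C"
      by (rule g_vec_proportional[OF C D])
    with \<open>D \<in> tight h {x}\<close> slack[OF xQ] show False
      by (simp add: tight_def)
  qed
  \<comment> \<open>Finitely many strict inequalities survive a small step in direction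
    \<open>\<g> C\<close>.\<close>
  have "eventually (\<lambda>e. \<forall>D\<in>\<B> - \<kappa> UNIV. \<g> D \<bullet> (x + e *\<^sub>R \<g> C) < h $ D) (at_right 0)"
  proof (rule eventually_ball_finite[OF finite], rule ballI)
    fix D assume D: "D \<in> \<B> - \<kappa> UNIV"
    have "((\<lambda>e. \<g> D \<bullet> (x + e *\<^sub>R \<g> C)) \<longlongrightarrow> \<g> D \<bullet> (x + 0 *\<^sub>R \<g> C)) (at_right 0)"
      by (intro tendsto_intros)
    then show "eventually (\<lambda>e. \<g> D \<bullet> (x + e *\<^sub>R \<g> C) < h $ D) (at_right 0)"
      by (rule order_tendstoD(2)) (use loose D in simp)
  qed
  moreover have "eventually (\<lambda>e. e > (0::real)) (at_right 0)"
    by (simp add: eventually_at_right_less)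
  ultimately have "eventually (\<lambda>e. e > 0 \<and> (\<forall>D\<in>\<B> - \<kappa> UNIV. \<g> D \<bullet> (x + e *\<^sub>R \<g> C) < h $ D)) (at_right 0)"
    by eventually_elim blast
  then obtain e :: real where e: "e > 0" "\<And>D. D \<in> \<B> - \<kappa> UNIV \<Longrightarrow> \<g> D \<bullet> (x + e *\<^sub>R \<g> C) < h $ D"
    using eventually_happens'[OF trivial_limit_at_right_real] by blast
  have "x + e *\<^sub>R \<g> C \<in> \<H>"
    using xQ nested_polytope_iff
    by (intro subspace_add subspace_scale subspace_ambient g_vec_ambient) blast
  moreover have "\<g> D \<bullet> (x + e *\<^sub>R \<g> C) \<le> h $ D" if "D \<in> \<B>" for D
    using e(2)[of D] that hK[of D] g_vec_component[of D] by (cases "D \<in> \<kappa> UNIV") auto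
  ultimately have "x + e *\<^sub>R \<g> C \<in> ?Q"
    by (simp add: nested_polytope_def)
  moreover have "\<g> C \<in> normal_cone \<H> ?Q F"
    unfolding nc by (rule hull_inc) simp
  ultimately have "\<g> C \<bullet> (x + e *\<^sub>R \<g> C) \<le> \<g> C \<bullet> x"
    using xF unfolding normal_cone_def by blast
  then have "\<g> C = 0"
    using e(1) inner_ge_zero[of "\<g> C"]
    by (auto simp: inner_add_right mult_le_0_iff)
  \<comment> \<open>A zero vector is a multiple of each \<open>\<g> {v}\<close>. If \<open>C\<close>
    were no component, it would equal every singleton and thus be all of \<open>UNIV\<close>, which
    is then a component.\<close>
  have "C \<in> \<kappa> UNIV"
  proof (rule ccontr)
    assume "C \<notin> \<kappa> UNIV"
    moreover have "\<g> C = 0 *\<^sub>R \<g> {v}" for v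
      using \<open>\<g> C = 0\<close> by simp
    ultimately have "C = {v}" for v
      using g_vec_proportional[OF singleton_block C] by blast
    then have "{v} = C" for v by simp
    then have "UNIV = C" by auto
    then show False
      using \<open>C \<notin> \<kappa> UNIV\<close> C comps_block[of UNIV] by simp
  qed
  then show False
    using slack[OF xQ] hK xQ nested_polytope_iff ambient_sum_comp by metis
qed

text \<open>The chain \<open>U \<inter> W\<close>, \<open>U \<union> W\<close>, \<open>UNIV\<close>
  gives a nested set, hence a point \<open>x\<close> tight at the first two. Modularity of the sums
  of \<open>x\<close> and the bounds for \<open>U\<close> and \<open>W\<close> yield the
  inequality.\<close>

lemma type_cone_subset_submod_cone: "type_cone \<B> \<subseteq> submod_cone"
proof
  fix h assume h: "h \<in> type_cone \<B>"
  let ?Q = "nested_polytope \<B> h"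
  have "submod_gap U W h \<ge> 0" for U W
  proof -
    let ?N = "\<Union>X\<in>{U \<inter> W, U \<union> W, UNIV}. \<kappa> X"
    have nested: "nested_set \<B> ?N"
      by (rule nested_set_comps_chain) auto
    obtain F where F: "F face_of ?Q" "F \<noteq> {}"
      and nc: "normal_cone \<H> ?Q F = convex_cone hull (\<g> ` ?N)"
      using type_cone_face[OF h nested] by blast
    then obtain x where x: "x \<in> F" "x \<in> ?Q"
      using face_of_imp_subset by blast
    have tight: "(\<Sum>v\<in>C. x $ v) = h $ C" if "C \<in> ?N" for C
    proof -
      have C: "C \<in> \<B>" using nested_setD(1)[OF nested that] .
      \<comment> \<open>Normality only says that \<open>x\<close> maximizes \<open>\<g> C\<close>; a
        point attaining \<open>h $ C\<close> turns this into tightness.\<close>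
      from type_cone_attained[OF h C] obtain z where z: "z \<in> ?Q" "(\<Sum>v\<in>C. z $ v) = h $ C"
        by blast
      have "\<g> C \<in> normal_cone \<H> ?Q F"
        unfolding nc by (rule hull_inc) (use that in blast)
      then have "\<g> C \<bullet> z \<le> \<g> C \<bullet> x"
        using x z unfolding normal_cone_def by blast
      then have "h $ C \<le> (\<Sum>v\<in>C. x $ v)"
        using x z nested_polytope_iff by (simp add: inner_g_vec)
      moreover have "(\<Sum>v\<in>C. x $ v) \<le> h $ C"
        using x(2) C nested_polytope_iff by blast
      ultimately show ?thesis by simp
    qed
    have "(\<Sum>v\<in>X. x $ v) = ext h X" if "\<kappa> X \<subseteq> ?N" for X
    proof -
      have "(\<Sum>v\<in>X. x $ v) = (\<Sum>C\<in>\<kappa> X. \<Sum>v\<in>C. x $ v)"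
        by (rule sum_comps[symmetric])
      also have "\<dots> = ext h X"
        unfolding ext_def by (rule sum.cong) (use that tight in auto)
      finally show ?thesis .
    qed
    then have "(\<Sum>v\<in>U \<union> W. x $ v) = ext h (U \<union> W)" "(\<Sum>v\<in>U \<inter> W. x $ v) = ext h (U \<inter> W)"
      by auto
    moreover have "(\<Sum>v\<in>U \<union> W. x $ v) + (\<Sum>v\<in>U \<inter> W. x $ v) = (\<Sum>v\<in>U. x $ v) + (\<Sum>v\<in>W. x $ v)"
      by (rule sum.union_inter) auto
    ultimately show ?thesis
      using nested_polytope_sum_le_ext[OF x(2), of U] nested_polytope_sum_le_ext[OF x(2), of W]
      by (simp add: submod_gap_def)
  qed
  then show "h \<in> submod_cone"
    using h by (simp add: submod_cone_def coord_space_def type_cone_def)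
qed

section \<open>Density of the strict cone\<close>

lemma subspace_coord_space: "subspace coord_space"
  by (auto simp: coord_space_def subspace_def)

lemma closed_submod_cone: "closed submod_cone"
proof -
  have "submod_cone = coord_space \<inter> (\<Inter>U W. {h. 0 \<le> submod_gap U W h})"
    by (auto simp: submod_cone_def)
  moreover have "closed {h. 0 \<le> submod_gap U W h}" for U W
    by (intro closed_Collect_le continuous_on_const continuous_submod_gap)
  ultimately show ?thesis
    using closed_subspace[OF subspace_coord_space] by (simp add: closed_Int closed_INT)
qed

lemma strict_submod_cone_nonempty:
  obtains h where "h \<in> strict_submod_cone"
proof -
  obtain h where h: "h \<in> coord_space" "\<And>U W. submod_gap U W h = sum (\<lambda>_. 1) (crossing U W)"
    using submod_gap_realize[of "\<lambda>_. 1"] by blast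
  then have "h \<in> strict_submod_cone"
    by (auto simp: strict_submod_cone_def submod_cone_def card_gt_0_iff)
  then show ?thesis using that by blast
qed

text \<open>The type cone lies between the strict cone and the closed submodular cone. Adding a
  vanishing positive multiple of a strict point to \<open>h\<close> approximates it from the strict
  cone.\<close>

lemma closure_type_cone: "closure (type_cone \<B>) = submod_cone"
proof
  show "closure (type_cone \<B>) \<subseteq> submod_cone"
    by (intro closure_minimal type_cone_subset_submod_cone closed_submod_cone)
  show "submod_cone \<subseteq> closure (type_cone \<B>)"
  proof
    fix h assume h: "h \<in> submod_cone"
    obtain h0 where h0: "h0 \<in> strict_submod_cone"
      by (rule strict_submod_cone_nonempty)
    have "h + inverse (real (Suc n)) *\<^sub>R h0 \<in> strict_submod_cone" for n
    proof -
      have "h + inverse (real (Suc n)) *\<^sub>R h0 \<in> coord_space"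
        using h h0 by (intro subspace_add subspace_scale subspace_coord_space)
          (auto simp: strict_submod_cone_def submod_cone_def)
      moreover have "submod_gap U W (h + inverse (real (Suc n)) *\<^sub>R h0)
          = submod_gap U W h + inverse (real (Suc n)) * submod_gap U W h0" for U W
        using linear_submod_gap[of U W] by (simp add: linear_add linear_scale)
      ultimately show ?thesis
        using h h0 by (auto simp: strict_submod_cone_def submod_cone_def add_nonneg_pos)
    qed
    then have "h + inverse (real (Suc n)) *\<^sub>R h0 \<in> type_cone \<B>" for n
      using strict_submod_cone_subset_type_cone by blast
    moreover have "(\<lambda>n. h + inverse (real (Suc n)) *\<^sub>R h0) \<longlonglongrightarrow> h + 0 *\<^sub>R h0"
      by (intro tendsto_intros LIMSEQ_inverse_real_of_nat)
    ultimately show "h \<in> closure (type_cone \<B>)"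
      unfolding closure_sequential by (intro exI conjI allI) (assumption, simp)
  qed
qed

subsection \<open>Exchange frames and facets\<close>

lemma maximal_nested_not_insert:
  assumes "maximal_nested_set \<B> \<N>" "C \<notin> \<N>"
  shows "\<not> nested_set \<B> (insert C \<N>)"
  using assms unfolding maximal_nested_set_def mem_incl_maximals_iff by blast

text \<open>All facts about frames used later. They follow from the impossibility of adding
  \<open>B'\<close> to the maximal nested set \<open>\<N>\<close>.\<close>

lemma exchange_frameD:
  assumes "exchange_frame \<B> B B' P"
  shows "B \<in> \<B>" "B' \<in> \<B>" "P \<in> \<B>" "B \<subset> P" "B' \<subset> P" "\<not> B \<subseteq> B'" "\<not> B' \<subseteq> B"
proof -
  obtain \<N> \<N>' where max: "maximal_nested_set \<B> \<N>"
    and max': "maximal_nested_set \<B> \<N>'" and B: "B \<in> \<N>" and B': "B' \<in> \<N>'" and "B \<noteq> B'"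
    and eq: "\<N> - {B} = \<N>' - {B'}" and P: "P \<in> incl_minimals {C \<in> \<N>. B \<subset> C}"
    using assms unfolding exchange_frame_def by blast
  have N: "nested_set \<B> \<N>" and N': "nested_set \<B> \<N>'"
    using max max' by (simp_all add: maximal_nested_set_def mem_incl_maximals_iff)
  have notin: "B' \<notin> \<N>"
    using eq \<open>B \<noteq> B'\<close> by blast
  have ins: "insert B' \<N> = insert B \<N>'"
    using eq B B' by blast
  have mem: "E = B \<or> E = B' \<or> E \<in> \<N> \<and> E \<in> \<N>'" if "E \<in> insert B' \<N>" for E
    using that ins by (metis insertE)
  have PN: "P \<in> \<N>" "B \<subset> P"
    using P by (auto simp: incl_minimals_def)
  then have PN': "P \<in> \<N>'" "P \<noteq> B'"
    using ins notin by auto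
  show blocks: "B \<in> \<B>" "B' \<in> \<B>" "P \<in> \<B>" "B \<subset> P"
    using nested_setD(1)[OF N B] nested_setD(1)[OF N' B'] nested_setD(1)[OF N PN(1)] PN(2) .
  \<comment> \<open>If \<open>B\<close> and \<open>B'\<close> are compatible, adding
    \<open>B'\<close> can only fail through a disjoint family with block union. It contains both,
    since otherwise it would lie in \<open>\<N>\<close> or in \<open>\<N>'\<close>.\<close>
  have obstruction: "\<exists>\<M>\<subseteq>insert B' \<N>. B \<in> \<M> \<and> B' \<in> \<M> \<and> pairwise disjnt \<M> \<and> \<Union>\<M> \<in> \<B>"
    if compat: "B \<subseteq> B' \<or> B' \<subseteq> B \<or> B \<inter> B' = {}"
  proof (rule ccontr)
    assume contra: "\<not> ?thesis"
    have "nested_set \<B> (insert B' \<N>)"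
      unfolding nested_set_def
    proof (intro conjI ballI allI impI)
      show "insert B' \<N> \<subseteq> \<B>" using nested_setD(1)[OF N] blocks(2) by blast
      show "block_components \<B> \<subseteq> insert B' \<N>" using nested_setD(4)[OF N] by blast
      show "C \<subseteq> D \<or> D \<subseteq> C \<or> C \<inter> D = {}" if CD: "C \<in> insert B' \<N>" "D \<in> insert B' \<N>" for C D
      proof -
        consider "C \<in> \<N>" "D \<in> \<N>" | "C \<in> \<N>'" "D \<in> \<N>'" | "C = B" "D = B'" | "C = B'" "D = B"
          using mem[OF CD(1)] mem[OF CD(2)] B B' by blast
        then show ?thesis
          using nested_setD(2)[OF N, of C D] nested_setD(2)[OF N', of C D] compat by cases auto
      qed
      fix \<M> assume M: "\<M> \<subseteq> insert B' \<N>" "2 \<le> card \<M> \<and> pairwise disjnt \<M>"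
      consider "B \<notin> \<M>" | "B' \<notin> \<M>" | "B \<in> \<M>" "B' \<in> \<M>" by blast
      then show "\<Union>\<M> \<notin> \<B>"
      proof cases
        case 1
        then have "\<M> \<subseteq> \<N>'" using M(1)[unfolded ins] by blast
        then show ?thesis using nested_setD(3)[OF N'] M(2) by blast
      next
        case 2
        then have "\<M> \<subseteq> \<N>" using M(1) by blast
        then show ?thesis using nested_setD(3)[OF N] M(2) by blast
      next
        case 3
        then show ?thesis using contra M by blast
      qed
    qed
    then show False
      using maximal_nested_not_insert[OF max notin] by blast
  qed
  have disj: "B \<inter> B' = {}" if "B \<subseteq> B' \<or> B' \<subseteq> B \<or> B \<inter> B' = {}"
    using obstruction[OF that] \<open>B \<noteq> B'\<close> by (auto simp: pairwise_def disjnt_def)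
  show incomp: "\<not> B \<subseteq> B'" "\<not> B' \<subseteq> B"
    using disj block_nonempty[OF blocks(1)] block_nonempty[OF blocks(2)] by blast+
  show "B' \<subset> P"
  proof (rule ccontr)
    assume "\<not> B' \<subset> P"
    then have B'P: "B' \<inter> P = {}"
      using nested_setD(2)[OF N' B' PN'(1)] PN'(2) PN(2) incomp(1) by blast
    then obtain \<M> where M: "\<M> \<subseteq> insert B' \<N>" "B \<in> \<M>" "B' \<in> \<M>" "pairwise disjnt \<M>" "\<Union>\<M> \<in> \<B>"
      using obstruction PN(2) by blast
    have M_disj: "E \<inter> E' = {}" if "E \<in> \<M>" "E' \<in> \<M>" "E \<noteq> E'" for E E'
      using M(4) that by (auto simp: pairwise_def disjnt_def)
    have B_ne: "B \<noteq> {}" using block_nonempty[OF blocks(1)] .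
    \<comment> \<open>Replacing the members inside \<open>P\<close> by \<open>P\<close> itself
      removes \<open>B\<close> from the obstruction. The new family lies in \<open>\<N>'\<close> and
      violates its nestedness.\<close>
    let ?M = "insert P {E \<in> \<M>. E \<inter> P = {}}"
    have sub: "?M \<subseteq> \<N>'"
      using M(1)[unfolded ins] PN'(1) PN(2) B_ne by blast
    have dich: "E \<subseteq> P \<or> E \<inter> P = {}" if E: "E \<in> \<M>" for E
    proof (cases "E = B \<or> E = B'")
      case True
      then show ?thesis using PN(2) B'P by blast
    next
      case False
      then have "E \<in> \<N>" using E M(1) by blast
      then have "E \<subseteq> P \<or> P \<subseteq> E \<or> E \<inter> P = {}"
        using nested_setD(2)[OF N _ PN(1)] by blast
      moreover have "\<not> P \<subseteq> E"
        using M_disj[OF E M(2)] False PN(2) B_ne by blast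
      ultimately show ?thesis by blast
    qed
    have "\<Union>?M = \<Union>\<M> \<union> P"
      using dich by blast
    also have "\<dots> \<in> \<B>"
      using block_Un[OF M(5) blocks(3)] M(2) PN(2) B_ne by blast
    finally have "\<Union>?M \<in> \<B>" .
    moreover have "pairwise disjnt ?M"
      using M_disj by (auto simp: pairwise_def disjnt_def)
    moreover have "card ?M \<ge> 2"
    proof -
      have "card {P, B'} \<le> card ?M"
        using M(3) B'P by (intro card_mono) auto
      then show ?thesis using PN'(2) by simp
    qed
    ultimately show False
      using nested_setD(3)[OF N' sub] by blast
  qed
qed

section \<open>The frame inequality as a defect of three sets\<close>

definition crossing3 :: "'v set \<Rightarrow> 'v set \<Rightarrow> 'v set \<Rightarrow> 'v set set" where
  "crossing3 X Y Z = {C \<in> \<B>. C \<subseteq> X \<union> Y \<union> Z \<and> \<not> C \<subseteq> X \<and> \<not> C \<subseteq> Y \<and> \<not> C \<subseteq> Z}"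

text \<open>As a sum of two defects it is visibly nonnegative on \<open>submod_cone\<close>.\<close>

definition gap3 :: "'v set \<Rightarrow> 'v set \<Rightarrow> 'v set \<Rightarrow> real ^ 'v set \<Rightarrow> real" where
  "gap3 X Y Z h = submod_gap X Y h + submod_gap (X \<union> Y) Z h"

text \<open>The hypothesis ensures that no block crossing \<open>(X, Y)\<close> is contained in
  \<open>Z\<close>. It allows \<open>Z\<close> to meet \<open>X\<close>, as happens for the triple
  \<open>D\<close>, \<open>B'\<close>, \<open>P - (B \<union> B')\<close> below.\<close>

lemma sum_crossing3:
  fixes y :: "'v set \<Rightarrow> real"
  assumes "(X \<union> Y) \<inter> Z \<subseteq> X"
  shows "sum y (crossing3 X Y Z) = sum y (crossing X Y) + sum y (crossing (X \<union> Y) Z)"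
proof -
  have "crossing3 X Y Z = crossing X Y \<union> crossing (X \<union> Y) Z"
    using assms unfolding crossing3_def crossing_def by blast
  moreover have "crossing X Y \<inter> crossing (X \<union> Y) Z = {}"
    unfolding crossing_def by blast
  ultimately show ?thesis
    by (simp add: sum.union_disjoint)
qed

lemma linear_gap3: "linear (gap3 X Y Z)"
  unfolding gap3_def[abs_def] by (intro linear_compose_add linear_submod_gap)

lemma gap3_nonneg: "h \<in> submod_cone \<Longrightarrow> gap3 X Y Z h \<ge> 0"
  by (simp add: gap3_def submod_cone_def)

text \<open>The terms \<open>ext h (B \<union> B')\<close> of the two defects cancel, and the second
  intersection is empty.\<close>

lemma frame_inequality_gap3:
  assumes "B \<in> \<B>" "B' \<in> \<B>" "P \<in> \<B>" "B \<subseteq> P" "B' \<subseteq> P"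
  shows "gap3 B B' (P - (B \<union> B')) h =
    (h $ B + h $ B' + (\<Sum>K\<in>\<kappa> (P - (B \<union> B')). h $ K)) - (h $ P + (\<Sum>K\<in>\<kappa> (B \<inter> B'). h $ K))"
proof -
  have "B \<union> B' \<union> (P - (B \<union> B')) = P" "(B \<union> B') \<inter> (P - (B \<union> B')) = {}"
    using assms by blast+
  then show ?thesis
    unfolding gap3_def submod_gap_def by (simp add: ext_empty ext_block assms) (simp add: ext_def)
qed

text \<open>The strict inequalities cut a nonempty relatively open subset out of
  \<open>coord_space\<close>, so facets have codimension one in \<open>coord_space\<close>.\<close>

lemma aff_dim_submod_cone: "aff_dim submod_cone = aff_dim coord_space"
proof -
  let ?O = "\<Inter>(U, W)\<in>{(U, W). crossing U W \<noteq> {}}. {h. 0 < submod_gap U W h}"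
  have "open ?O"
    by (intro open_INT finite ballI) (auto intro: open_Collect_less continuous_submod_gap)
  moreover obtain h0 where h0: "h0 \<in> strict_submod_cone"
    by (rule strict_submod_cone_nonempty)
  moreover from h0 have "h0 \<in> coord_space \<inter> ?O"
    by (auto simp: strict_submod_cone_def submod_cone_def)
  ultimately have "aff_dim (coord_space \<inter> ?O) = aff_dim coord_space"
    by (intro aff_dim_convex_Int_open subspace_imp_convex subspace_coord_space) blast+
  moreover have "coord_space \<inter> ?O \<subseteq> submod_cone"
  proof
    fix h assume h: "h \<in> coord_space \<inter> ?O"
    have "submod_gap U W h > 0" if "crossing U W \<noteq> {}" for U W
      using h that by auto
    then have "submod_gap U W h \<ge> 0" for U W
      using submod_gap_crossing_empty[of U W h] by (cases "crossing U W = {}") (auto intro: less_imp_le)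
    then show "h \<in> submod_cone"
      using h by (simp add: submod_cone_def)
  qed
  then have "aff_dim (coord_space \<inter> ?O) \<le> aff_dim submod_cone"
    by (rule aff_dim_subset)
  moreover have "aff_dim submod_cone \<le> aff_dim coord_space"
    by (rule aff_dim_subset) (auto simp: submod_cone_def)
  ultimately show ?thesis by simp
qed

lemma gap3_as_sum:
  assumes "(X \<union> Y) \<inter> Z \<subseteq> X" "\<And>U W. submod_gap U W h = sum y (crossing U W)"
  shows "gap3 X Y Z h = sum y (crossing3 X Y Z)"
  by (simp add: gap3_def assms(2) sum_crossing3[OF assms(1)])

text \<open>By maximality, a block inside \<open>P\<close> that meets \<open>B\<close> without lying
  in it covers \<open>P\<close> together with \<open>B\<close>, and likewise for \<open>B'\<close>.
  A block of \<open>crossing3\<close> inside \<open>U\<close> or \<open>W\<close> would thus force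
  \<open>P\<close> into one of the two.\<close>

lemma maximal_frame_crossing:
  assumes B: "B \<in> \<B>" "B \<subset> P" "\<And>C. C \<in> \<B> \<Longrightarrow> B \<subset> C \<Longrightarrow> C \<subseteq> P \<Longrightarrow> C = P"
    and B': "B' \<in> \<B>" "B' \<subset> P" "\<And>C. C \<in> \<B> \<Longrightarrow> B' \<subset> C \<Longrightarrow> C \<subseteq> P \<Longrightarrow> C = P"
    and "B \<noteq> B'" and P: "P \<in> crossing U W" and sub: "crossing U W \<subseteq> crossing3 B B' (P - (B \<union> B'))"
  shows "crossing U W = crossing3 B B' (P - (B \<union> B'))"
proof
  show "crossing U W \<subseteq> crossing3 B B' (P - (B \<union> B'))" by fact
  have PUW: "P \<subseteq> U \<union> W" "\<not> P \<subseteq> U" "\<not> P \<subseteq> W"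
    using P by (auto simp: crossing_def)
  have "B \<notin> crossing U W" "B' \<notin> crossing U W"
    using sub by (auto simp: crossing3_def)
  \<comment> \<open>Neither frame block belongs to \<open>crossing3\<close>, hence neither crosses
    \<open>(U, W)\<close>.\<close>
  then have BUW: "B \<subseteq> U \<or> B \<subseteq> W" "B' \<subseteq> U \<or> B' \<subseteq> W"
    using B(1,2) B'(1,2) PUW(1) unfolding crossing_def by blast+
  have absorb: "C \<union> B = P" if "C \<in> \<B>" "C \<subseteq> P" "\<not> C \<subseteq> B" "C \<inter> B \<noteq> {}" for C
    using B(3)[of "C \<union> B"] block_Un[OF that(1) B(1) that(4)] that B(2) by blast
  have absorb': "C \<union> B' = P" if "C \<in> \<B>" "C \<subseteq> P" "\<not> C \<subseteq> B'" "C \<inter> B' \<noteq> {}" for C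
    using B'(3)[of "C \<union> B'"] block_Un[OF that(1) B'(1) that(4)] that B'(2) by blast
  have BB': "\<not> B \<subseteq> B'" "\<not> B' \<subseteq> B"
    using B'(3)[OF B(1)] B(3)[OF B'(1)] B(2) B'(2) \<open>B \<noteq> B'\<close> by blast+
  have main: "\<not> C \<subseteq> X"
    if C: "C \<in> crossing3 B B' (P - (B \<union> B'))" and X: "\<not> P \<subseteq> X" "\<not> P \<subseteq> Y"
      "B \<subseteq> X \<or> B \<subseteq> Y" "B' \<subseteq> X \<or> B' \<subseteq> Y" for C X Y
  proof
    assume CX: "C \<subseteq> X"
    have C': "C \<in> \<B>" "C \<subseteq> P" "\<not> C \<subseteq> B" "\<not> C \<subseteq> B'" "\<not> C \<subseteq> P - (B \<union> B')"
      using C B(2) B'(2) by (auto simp: crossing3_def)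
    show False
    proof (cases "B \<inter> B' = {}")
      case True
      \<comment> \<open>A block \<open>C\<close> meeting one of the two covers the rest of
        \<open>P\<close>, hence meets the other as well; the two absorptions give
        \<open>C = P\<close>.\<close>
      have "C \<inter> B \<noteq> {} \<or> C \<inter> B' \<noteq> {}"
        using C'(2,5) by blast
      then have "C \<inter> B \<noteq> {} \<and> C \<inter> B' \<noteq> {}"
        using absorb[OF C'(1-3)] absorb'[OF C'(1,2,4)] True B(2) B'(2)
          block_nonempty[OF B(1)] block_nonempty[OF B'(1)] by blast
      then have "C \<union> B = P" "C \<union> B' = P"
        using absorb[OF C'(1-3)] absorb'[OF C'(1,2,4)] by blast+
      then have "C = P" using True by blast
      then show False using CX X(1) by blast
    next
      case False
      then have "B \<union> B' = P"
        using absorb'[OF B(1)] B(2) BB' by blast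
      \<comment> \<open>Otherwise \<open>Y\<close> would contain both and hence \<open>P\<close>.
        Whichever lies in \<open>X\<close> is disjoint from \<open>C\<close>, which leaves
        \<open>C\<close> inside the other.\<close>
      then have "B \<subseteq> X \<or> B' \<subseteq> X"
        using X by blast
      then show False
      proof
        assume "B \<subseteq> X"
        then have "C \<inter> B = {}"
          using absorb[OF C'(1-3)] CX X(1) by blast
        then show False using C'(2,4) \<open>B \<union> B' = P\<close> by blast
      next
        assume "B' \<subseteq> X"
        then have "C \<inter> B' = {}"
          using absorb'[OF C'(1,2,4)] CX X(1) by blast
        then show False using C'(2,3) \<open>B \<union> B' = P\<close> by blast
      qed
    qed
  qed
  show "crossing3 B B' (P - (B \<union> B')) \<subseteq> crossing U W"
  proof
    fix C assume C: "C \<in> crossing3 B B' (P - (B \<union> B'))"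
    have "\<not> C \<subseteq> U"
      by (rule main[OF C PUW(2,3) BUW])
    moreover have "\<not> C \<subseteq> W"
      by (rule main[OF C PUW(3,2)]) (use BUW in blast)+
    moreover have "C \<in> \<B>" "C \<subseteq> P"
      using C B(2) B'(2) by (auto simp: crossing3_def)
    ultimately show "C \<in> crossing U W"
      using PUW(1) by (auto simp: crossing_def)
  qed
qed

lemma convex_submod_cone: "convex submod_cone"
proof (rule convexI)
  fix h h' :: "real ^ 'v set" and a b :: real
  assume h: "h \<in> submod_cone" "h' \<in> submod_cone" "a \<ge> 0" "b \<ge> 0"
  have "a *\<^sub>R h + b *\<^sub>R h' \<in> coord_space"
    using h by (intro subspace_add subspace_scale subspace_coord_space) (auto simp: submod_cone_def)
  moreover have "submod_gap U W (a *\<^sub>R h + b *\<^sub>R h') = a * submod_gap U W h + b * submod_gap U W h'" for U W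
    using linear_submod_gap[of U W] by (simp add: linear_add linear_scale)
  ultimately show "a *\<^sub>R h + b *\<^sub>R h' \<in> submod_cone"
    using h by (simp add: submod_cone_def)
qed

text \<open>Lowering the coefficient of \<open>P\<close> until the frame inequality is tight keeps all the other
  submodular inequalities strict, provided that the blocks outside \<open>T\<close> carry a large weight.\<close>

lemma facet_if_crossing_rigid:
  assumes XYZ: "(X \<union> Y) \<inter> Z \<subseteq> X" and T: "T = crossing3 X Y Z" and PT: "P \<in> T"
    and rigid: "\<And>U W. P \<in> crossing U W \<Longrightarrow> crossing U W \<subseteq> T \<Longrightarrow> crossing U W = T"
  shows "{h \<in> submod_cone. gap3 X Y Z h = 0} facet_of submod_cone"
proof -
  let ?L = "gap3 X Y Z"
  \<comment> \<open>The weight of \<open>P\<close> balances the unit weights of the rest of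
    \<open>T\<close>, and a single block outside \<open>T\<close> outweighs it.\<close>
  define y :: "'v set \<Rightarrow> real" where
    "y C = (if C = P then - real (card (T - {P})) else if C \<in> T then 1 else real (card T) + 1)" for C
  have y_pos: "y C > 0" if "C \<noteq> P" for C
    using that by (simp add: y_def add_pos_nonneg)
  have y_P: "sum y S = y P + sum y (S - {P})" if "P \<in> S" for S
    using that by (simp add: sum.remove)
  have "sum y (T - {P}) = sum (\<lambda>_. 1) (T - {P})"
    by (rule sum.cong) (auto simp: y_def)
  then have sum_T: "sum y T = 0"
    using y_P[OF PT] by (simp add: y_def)
  obtain h1 where h1: "h1 \<in> coord_space" "\<And>U W. submod_gap U W h1 = sum y (crossing U W)"
    using submod_gap_realize[of y] by blast
  have L_h1: "?L h1 = 0"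
    using gap3_as_sum[OF XYZ h1(2)] sum_T T by simp
  have dich: "submod_gap U W h1 > 0 \<or> crossing U W = {} \<or> crossing U W = T" for U W
  proof (cases "P \<in> crossing U W")
    case False
    then have "sum y (crossing U W) > 0" if "crossing U W \<noteq> {}"
      using that y_pos by (intro sum_pos) (auto, metis)
    then show ?thesis using h1(2) by auto
  next
    case True
    show ?thesis
    proof (cases "crossing U W \<subseteq> T")
      case True
      then show ?thesis using rigid \<open>P \<in> crossing U W\<close> by blast
    next
      case False
      then obtain C where C: "C \<in> crossing U W" "C \<notin> T" by blast
      have "y C \<le> sum y (crossing U W - {P})"
        using C PT y_pos by (intro member_le_sum) (auto intro: less_imp_le)
      moreover have "y C = real (card T) + 1" "y P = - real (card (T - {P}))"
        using C PT by (auto simp: y_def)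
      moreover have "card (T - {P}) \<le> card T"
        by (rule card_mono) auto
      ultimately have "sum y (crossing U W) > 0"
        using y_P[OF True] by simp
      then show ?thesis using h1(2) by simp
    qed
  qed
  have gap_T: "submod_gap U W h = ?L h" if "crossing U W = T" for U W h
  proof -
    obtain z where z: "\<And>U W. submod_gap U W h = sum z (crossing U W)"
      using submod_gap_as_sum[of h] by blast
    then show ?thesis
      using gap3_as_sum[OF XYZ z] that T by simp
  qed
  \<comment> \<open>The vector representing the functional, as required for hyperplanes.\<close>
  define a where "a = adjoint ?L 1"
  have a: "a \<bullet> h = ?L h" for h
    using adjoint_works[OF linear_gap3[of X Y Z], of h 1] by (simp add: a_def inner_commute)
  let ?G = "{h \<in> submod_cone. ?L h = 0}" and ?E = "coord_space \<inter> {h. a \<bullet> h = 0}"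
  let ?O = "\<Inter>(U, W)\<in>{(U, W). submod_gap U W h1 > 0}. {h. 0 < submod_gap U W h}"
  have "open ?O"
    by (intro open_INT finite ballI) (auto intro: open_Collect_less continuous_submod_gap)
  moreover have h1_mem: "h1 \<in> ?E \<inter> ?O"
    using h1(1) L_h1 by (auto simp: a)
  moreover have "convex ?E"
    by (intro convex_Int subspace_imp_convex subspace_coord_space convex_hyperplane)
  ultimately have "aff_dim (?E \<inter> ?O) = aff_dim ?E"
    by (intro aff_dim_convex_Int_open) blast+
  \<comment> \<open>Defects positive at \<open>h1\<close> stay positive on \<open>?O\<close>; the
    others are identically zero or equal to \<open>?L\<close>, which vanishes on
    \<open>?E\<close>.\<close>
  moreover have sub: "?E \<inter> ?O \<subseteq> ?G"
  proof
    fix h assume h: "h \<in> ?E \<inter> ?O"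
    have pos: "submod_gap U W h > 0" if "submod_gap U W h1 > 0" for U W
      using h that by auto
    have L0: "?L h = 0"
      using h by (simp add: a)
    have "submod_gap U W h \<ge> 0" for U W
      using dich[of U W] pos[of U W] submod_gap_crossing_empty[of U W h] gap_T[of U W h] L0
      by (auto intro: less_imp_le)
    then show "h \<in> ?G"
      using h by (simp add: submod_cone_def a)
  qed
  then have "aff_dim (?E \<inter> ?O) \<le> aff_dim ?G"
    by (rule aff_dim_subset)
  moreover have "aff_dim ?G \<le> aff_dim ?E"
    by (rule aff_dim_subset) (auto simp: submod_cone_def a)
  moreover have "aff_dim ?E = aff_dim coord_space - 1"
  proof -
    \<comment> \<open>Unit weights give \<open>?L\<close> the value \<open>card T\<close>, which is
      positive; so the hyperplane is proper and lowers the dimension by one.\<close>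
    obtain h where h: "h \<in> coord_space" "\<And>U W. submod_gap U W h = sum (\<lambda>_. 1) (crossing U W)"
      using submod_gap_realize[of "\<lambda>_. 1"] by blast
    have "?L h = card T"
      using gap3_as_sum[OF XYZ h(2)] T by simp
    then have "a \<bullet> h \<noteq> 0"
      using PT by (auto simp: a card_eq_0_iff)
    then have "\<not> coord_space \<subseteq> {h. a \<bullet> h = 0}" "?E \<noteq> {}"
      using h(1) h1_mem by blast+
    then show ?thesis
      by (simp add: aff_dim_affine_Int_hyperplane subspace_imp_affine subspace_coord_space)
  qed
  moreover have "?G face_of submod_cone"
  proof -
    have "?G = submod_cone \<inter> {h. a \<bullet> h = 0}"
      by (auto simp: a)
    then show ?thesis
      using face_of_Int_supporting_hyperplane_ge[OF convex_submod_cone, of 0 a] gap3_nonneg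
      by (simp add: a)
  qed
  moreover have "?G \<noteq> {}"
    using sub h1_mem by blast
  ultimately show ?thesis
    by (simp add: facet_of_def aff_dim_submod_cone)
qed

text \<open>The inequality splits into two valid ones, so both are equalities on the face. Their
  independence makes the codimension at least two.\<close>

lemma not_facet_if_not_maximal:
  assumes P: "P \<in> \<B>" and B: "B \<noteq> {}" "\<not> B \<subseteq> B'" "B' \<subset> P" and D: "D \<in> \<B>" "B \<subset> D" "D \<subset> P"
  shows "\<not> {h \<in> submod_cone. gap3 B B' (P - (B \<union> B')) h = 0} facet_of submod_cone"
proof
  let ?R = "P - (B \<union> B')"
  let ?G = "{h \<in> submod_cone. gap3 B B' ?R h = 0}"
  let ?T = "crossing3 B B' ?R" and ?T1 = "crossing3 B (B' \<inter> D) (?R \<inter> D)" and ?T2 = "crossing3 D B' ?R"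
  define L1 where "L1 = gap3 B (B' \<inter> D) (?R \<inter> D)"
  define L2 where "L2 = gap3 D B' ?R"
  have L1_sum: "L1 h = sum y ?T1" and L2_sum: "L2 h = sum y ?T2" and L_sum: "gap3 B B' ?R h = sum y ?T"
    if "\<And>U W. submod_gap U W h = sum y (crossing U W)" for h y
    unfolding L1_def L2_def by (rule gap3_as_sum[OF _ that]; blast)+
  have cover: "B \<union> B' \<union> ?R = P" "B \<union> (B' \<inter> D) \<union> (?R \<inter> D) = D" "D \<union> B' \<union> ?R = P"
    using B(3) D(2,3) by blast+
  have mono: "C \<subseteq> D \<Longrightarrow> C \<subseteq> P" "C \<subseteq> B \<Longrightarrow> C \<subseteq> D" for C
    using D(2,3) by blast+
  \<comment> \<open>\<open>?T1\<close> collects the blocks of \<open>?T\<close> inside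
    \<open>D\<close>, and \<open>?T2\<close> the remaining ones.\<close>
  have T: "?T = ?T1 \<union> ?T2" "?T1 \<inter> ?T2 = {}"
    unfolding crossing3_def cover Int_subset_iff using mono by auto
  have DT: "D \<in> ?T1" "D \<notin> ?T2"
    using B(1,2) D by (auto simp: crossing3_def)
  have PT: "P \<notin> ?T1" "P \<in> ?T2"
    using P B D by (auto simp: crossing3_def)
  have L_split: "gap3 B B' ?R h = L1 h + L2 h" for h
  proof -
    obtain z where z: "\<And>U W. submod_gap U W h = sum z (crossing U W)"
      using submod_gap_as_sum[of h] by blast
    show ?thesis
      unfolding L1_sum[OF z] L2_sum[OF z] L_sum[OF z] T(1)
      by (rule sum.union_disjoint) (use T(2) in auto)
  qed
  let ?E1 = "coord_space \<inter> {h. L1 h = 0}"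
  let ?E2 = "?E1 \<inter> {h. L2 h = 0}"
  have lin: "linear L1" "linear L2"
    by (simp_all add: L1_def L2_def linear_gap3)
  have aff: "affine coord_space" "affine ?E1" "affine ?E2"
    by (intro subspace_imp_affine subspace_inter subspace_coord_space linear_subspace_kernel lin)+
  have "?G \<subseteq> ?E2"
  proof
    fix h assume h: "h \<in> ?G"
    then have "L1 h + L2 h = 0" "L1 h \<ge> 0" "L2 h \<ge> 0" "h \<in> coord_space"
      using L_split[of h] gap3_nonneg[of h] by (auto simp: L1_def L2_def submod_cone_def)
    then show "h \<in> ?E2" by auto
  qed
  then have "aff_dim ?G \<le> aff_dim ?E2"
    by (rule aff_dim_subset)
  moreover have "aff_dim ?E2 < aff_dim ?E1"
  proof (rule aff_dim_psubset)
    \<comment> \<open>A point of \<open>?E1\<close> outside \<open>?E2\<close>: all weight sits on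
      \<open>P\<close>, which lies in \<open>?T2\<close> but not in \<open>?T1\<close>.\<close>
    obtain h where h: "h \<in> coord_space"
      "\<And>U W. submod_gap U W h = sum (\<lambda>C. of_bool (C = P)) (crossing U W)"
      using submod_gap_realize[of "\<lambda>C. of_bool (C = P)"] by blast
    have "L1 h = 0" "L2 h \<noteq> 0"
      using L1_sum[OF h(2)] L2_sum[OF h(2)] PT by (simp_all add: of_bool_def)
    then show "affine hull ?E2 \<subset> affine hull ?E1"
      unfolding affine_hull_eq[THEN iffD2, OF aff(2)] affine_hull_eq[THEN iffD2, OF aff(3)]
      using h(1) by blast
  qed
  moreover have "aff_dim ?E1 < aff_dim coord_space"
  proof (rule aff_dim_psubset)
    obtain h where h: "h \<in> coord_space"
      "\<And>U W. submod_gap U W h = sum (\<lambda>C. of_bool (C = D)) (crossing U W)"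
      using submod_gap_realize[of "\<lambda>C. of_bool (C = D)"] by blast
    have "L1 h \<noteq> 0"
      using L1_sum[OF h(2)] DT by (simp add: of_bool_def)
    then show "affine hull ?E1 \<subset> affine hull coord_space"
      unfolding affine_hull_eq[THEN iffD2, OF aff(1)] affine_hull_eq[THEN iffD2, OF aff(2)]
      using h(1) by blast
  qed
  ultimately have "aff_dim ?G < aff_dim submod_cone - 1"
    by (simp add: aff_dim_submod_cone)
  moreover assume "?G facet_of submod_cone"
  ultimately show False
    by (simp add: facet_of_def)
qed

lemma extremal_frame_iff_facet:
  assumes "exchange_frame \<B> B B' P"
  shows "extremal_frame \<B> B B' P \<longleftrightarrow>
    {h \<in> submod_cone. gap3 B B' (P - (B \<union> B')) h = 0} facet_of submod_cone"
proof -
  note D = exchange_frameD[OF assms]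
  have gap: "gap3 B B' (P - (B \<union> B')) h =
    (h $ B + h $ B' + (\<Sum>K\<in>\<kappa> (P - (B \<union> B')). h $ K)) - (h $ P + (\<Sum>K\<in>\<kappa> (B \<inter> B'). h $ K))" for h
    using D by (intro frame_inequality_gap3) auto
  have "\<forall>h\<in>submod_cone. gap3 B B' (P - (B \<union> B')) h \<ge> 0"
    using gap3_nonneg by blast
  then show ?thesis
    unfolding extremal_frame_def defines_facet_def closure_type_cone by (simp add: gap)
qed

lemma gap3_commute: "gap3 X Y Z h = gap3 Y X Z h"
  by (simp add: gap3_def submod_gap_def Un_commute Int_commute)

theorem extremal_iff_maximal:
  assumes frame: "exchange_frame \<B> B B' P"
  shows "extremal_frame \<B> B B' P \<longleftrightarrow> maximal_frame \<B> B B' P"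
proof
  note fr = exchange_frameD[OF frame]
  let ?R = "P - (B \<union> B')"
  {
    assume "maximal_frame \<B> B B' P"
    then have max: "\<And>C. C \<in> \<B> \<Longrightarrow> B \<subset> C \<Longrightarrow> C \<subseteq> P \<Longrightarrow> C = P"
      "\<And>C. C \<in> \<B> \<Longrightarrow> B' \<subset> C \<Longrightarrow> C \<subseteq> P \<Longrightarrow> C = P"
      unfolding maximal_frame_def incl_maximals_def by blast+
    have ne: "B \<noteq> B'" using fr(6) by blast
    have "P \<in> crossing3 B B' ?R"
      using fr block_nonempty[OF fr(1)] by (auto simp: crossing3_def)
    then have "{h \<in> submod_cone. gap3 B B' ?R h = 0} facet_of submod_cone"
      using maximal_frame_crossing[OF fr(1,4) max(1) fr(2,5) max(2) ne]
      by (intro facet_if_crossing_rigid[OF _ refl, of _ _ _ P]) auto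
    then show "extremal_frame \<B> B B' P"
      by (simp add: extremal_frame_iff_facet[OF frame])
  }
  assume "extremal_frame \<B> B B' P"
  then have facet: "{h \<in> submod_cone. gap3 B B' ?R h = 0} facet_of submod_cone"
    by (simp add: extremal_frame_iff_facet[OF frame])
  \<comment> \<open>Exchanging the roles of the frame blocks excludes blocks strictly between
    \<open>B'\<close> and \<open>P\<close> too.\<close>
  then have facet': "{h \<in> submod_cone. gap3 B' B (P - (B' \<union> B)) h = 0} facet_of submod_cone"
    by (simp add: gap3_commute Un_commute)
  show "maximal_frame \<B> B B' P"
    unfolding maximal_frame_def incl_maximals_def
    using not_facet_if_not_maximal[OF fr(3) block_nonempty[OF fr(1)] fr(6,5)] facet
      not_facet_if_not_maximal[OF fr(3) block_nonempty[OF fr(2)] fr(7,4)] facet' fr(1,2,4,5)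
    by blast
qed

end

theorem theorem3p26:
  fixes \<B> :: "'v::finite set set" and B B' P :: "'v set"
  assumes "building_set \<B>" and "exchange_frame \<B> B B' P"
  shows "extremal_frame \<B> B B' P \<longleftrightarrow> maximal_frame \<B> B B' P"
  using building.extremal_iff_maximal[OF building.intro] assms by blast

end
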